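(* Let $F:(M,g_M,J)\to(B,g_B)$ be a generic Riemannian submersion from a nearly Kaehler manifold onto a Riemannian manifold such that $M$ has constant holomorphic sectional curvature $c$ and constant type $\alpha$. If the distribution $\mathcal{D}$ is integrable and $F$ has totally umbilical fibers, then $c=\alpha$.
   Context: An almost Hermitian manifold $(M,g_M,J)$ is a Riemannian manifold with an almost complex structure $J$ such that $J^2=-I$ and $g_M(JX,JY)=g_M(X,Y)$; $\nabla$ is the Levi-Civita connection of $g_M$. It is nearly Kaehler if $(\nabla_XJ)Y+(\nabla_YJ)X=0$ for all $X,Y$. A Riemannian submersion $F:(M,g_M)\to(B,g_B)$ (with $\dim M>\dim B$) is a smooth map of maximal rank whose differential $F_*$ preserves the scalar product of vectors normal to the fibers. $\ker F_*$ is the vertical distribution, its orthogonal complement $(\ker F_* )^\perp$ the horizontal distribution; $\mathcal{V},\mathcal{H}$ denote the orthogonal projections of $TM$ onto them. $F$ is a generic Riemannian submersion if there is a distribution $\mathcal{D}\subset\ker F_*$ with $\ker F_*=\mathcal{D}\oplus\mathcal{D}^\perp$ and $J\mathcal{D}=\mathcal{D}$, where $\mathcal{D}^\perp$ is the orthogonal complement of $\mathcal{D}$ in $\ker F_*$ and is purely real, i.e. $\mathcal{D}^\perp\cap J\mathcal{D}^\perp=\{0\}$. O'Neill's tensor: $\mathcal{T}_{E}G=\mathcal{H}\nabla_{\mathcal{V}E}\mathcal{V}G+\mathcal{V}\nabla_{\mathcal{V}E}\mathcal{H}G$ for vector fields $E,G$ on $M$. $F$ has totally umbilical fibers if $\mathcal{T}_UV=g_M(U,V)H^{\star}$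 for all $U,V\in\Gamma(\ker F_* )$, where $H^{\star}$ is the mean curvature vector field of the fibers. $M$ has constant holomorphic sectional curvature $c$ if the sectional curvature of the plane spanned by $X$ and $JX$ equals the constant $c$ for every nonzero tangent vector $X$. $M$ has constant type $\alpha$ ($\alpha$ a constant) if $\|(\nabla_XJ)Y\|^2=\alpha\{\|X\|^2\|Y\|^2-g_M(X,Y)^2-g_M(X,JY)^2\}$ for all vector fields $X,Y$ on $M$.
   Formalization: Both D and its orthogonal complement in ker F_* are assumed nonzero. Without this the claim fails: for D=0, flat R^2→R has c=0 and any α; for D^⊥=0, the twistor fibration CP^3→S^4 has c=4, α=0. *)

theory Defs
  imports "HOL-Analysis.Analysis"
begin

section \<open>Smooth functions on open subsets of Euclidean spaces\<close>

text \<open>Meaningful for open \<open>S\<close> only; every use below is on an open set.\<close>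

primrec Ck_on :: "nat \<Rightarrow> 'a::euclidean_space set \<Rightarrow> ('a \<Rightarrow> 'b::real_normed_vector) \<Rightarrow> bool" where
  "Ck_on 0 S f \<longleftrightarrow> continuous_on S f"
| "Ck_on (Suc k) S f \<longleftrightarrow>
     (\<forall>x\<in>S. f differentiable (at x)) \<and> (\<forall>v. Ck_on k S (\<lambda>x. frechet_derivative f (at x) v))"

definition smooth_on :: "'a::euclidean_space set \<Rightarrow> ('a \<Rightarrow> 'b::real_normed_vector) \<Rightarrow> bool" where
  "smooth_on S f \<longleftrightarrow> (\<forall>k. Ck_on k S f)"


section \<open>Smooth manifolds\<close>

text \<open>A manifold is a Hausdorff, second countable space (the whole type \<open>'m\<close>) with a smooth atlas
  modelled on a Euclidean space \<open>'e\<close>, so its dimension is \<open>DIM('e)\<close>.  The atlas need not be maximal.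
  A chart is a pair of a domain and a coordinate map; the values of the coordinate map outside the
  domain are irrelevant.\<close>

type_synonym ('m, 'e) chart = "'m set \<times> ('m \<Rightarrow> 'e)"

abbreviation cdom :: "('m, 'e) chart \<Rightarrow> 'm set" where "cdom \<equiv> fst"
abbreviation cmap :: "('m, 'e) chart \<Rightarrow> 'm \<Rightarrow> 'e" where "cmap \<equiv> snd"

definition cinv :: "('m, 'e) chart \<Rightarrow> 'e \<Rightarrow> 'm" where
  "cinv c = inv_into (cdom c) (cmap c)"

definition is_chart :: "('m::topological_space, 'e::euclidean_space) chart \<Rightarrow> bool" where
  "is_chart c \<longleftrightarrow> open (cdom c) \<and> open (cmap c ` cdom c) \<and>
     homeomorphism (cdom c) (cmap c ` cdom c) (cmap c) (cinv c)"

definition smooth_atlas ::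
  "('m::{t2_space,second_countable_topology}, 'e::euclidean_space) chart set \<Rightarrow> bool" where
  "smooth_atlas A \<longleftrightarrow> (\<forall>c\<in>A. is_chart c) \<and> (\<Union>c\<in>A. cdom c) = UNIV \<and>
     (\<forall>c\<in>A. \<forall>d\<in>A. smooth_on (cmap c ` (cdom c \<inter> cdom d)) (cmap d \<circ> cinv c))"

definition chart_at :: "('m, 'e) chart set \<Rightarrow> 'm \<Rightarrow> ('m, 'e) chart" where
  "chart_at A p = (SOME c. c \<in> A \<and> p \<in> cdom c)"

text \<open>Tangent vectors at \<open>p\<close> are pairs (chart around \<open>p\<close>, coordinate vector) modulo change of chart.
  Each class has a unique representative whose chart is \<open>chart_at A p\<close>, so the tangent space at \<open>p\<close>
  is represented by the type \<open>'e\<close>, an element being the coordinate vector with respect to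
  \<open>chart_at A p\<close>.  Accordingly a vector field is a function \<open>'m \<Rightarrow> 'e\<close>, and its components in an
  arbitrary chart \<open>c\<close> are obtained from \<open>tchart A c p\<close>, the differential of \<open>cmap c\<close> at \<open>p\<close>.
  The norm and inner product of \<open>'e\<close> have no geometric meaning here.\<close>

definition tchart ::
  "('m, 'e) chart set \<Rightarrow> ('m, 'e::euclidean_space) chart \<Rightarrow> 'm \<Rightarrow> 'e \<Rightarrow> 'e" where
  "tchart A c p = frechet_derivative (cmap c \<circ> cinv (chart_at A p)) (at (cmap (chart_at A p) p))"

definition vf_rep ::
  "('m, 'e) chart set \<Rightarrow> ('m, 'e::euclidean_space) chart \<Rightarrow> ('m \<Rightarrow> 'e) \<Rightarrow> 'e \<Rightarrow> 'e" where
  "vf_rep A c X x = tchart A c (cinv c x) (X (cinv c x))"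

definition smooth_fun ::
  "('m, 'e::euclidean_space) chart set \<Rightarrow> 'm set \<Rightarrow> ('m \<Rightarrow> real) \<Rightarrow> bool" where
  "smooth_fun A U f \<longleftrightarrow> (\<forall>c\<in>A. smooth_on (cmap c ` (U \<inter> cdom c)) (f \<circ> cinv c))"

definition smooth_vf ::
  "('m, 'e::euclidean_space) chart set \<Rightarrow> 'm set \<Rightarrow> ('m \<Rightarrow> 'e) \<Rightarrow> bool" where
  "smooth_vf A U X \<longleftrightarrow> (\<forall>c\<in>A. smooth_on (cmap c ` (U \<inter> cdom c)) (vf_rep A c X))"

definition dir_deriv ::
  "('m, 'e::euclidean_space) chart set \<Rightarrow> ('m \<Rightarrow> real) \<Rightarrow> 'm \<Rightarrow> 'e \<Rightarrow> real" where
  "dir_deriv A f p v =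
     frechet_derivative (f \<circ> cinv (chart_at A p)) (at (cmap (chart_at A p) p)) v"

text \<open>\<open>[X,Y] = DY(X) - DX(Y)\<close> in the coordinates \<open>chart_at A p\<close>, in which the components of
  \<open>X\<close> and \<open>Y\<close> at \<open>p\<close> are \<open>X p\<close> and \<open>Y p\<close> themselves.\<close>

definition lie_bracket ::
  "('m, 'e::euclidean_space) chart set \<Rightarrow> ('m \<Rightarrow> 'e) \<Rightarrow> ('m \<Rightarrow> 'e) \<Rightarrow> 'm \<Rightarrow> 'e" where
  "lie_bracket A X Y p = (let c = chart_at A p; x = cmap c p in
     frechet_derivative (vf_rep A c Y) (at x) (X p) - frechet_derivative (vf_rep A c X) (at x) (Y p))"

definition smooth_map ::
  "('m::topological_space, 'e::euclidean_space) chart set \<Rightarrow>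
   ('b::topological_space, 'f::euclidean_space) chart set \<Rightarrow> ('m \<Rightarrow> 'b) \<Rightarrow> bool" where
  "smooth_map A B F \<longleftrightarrow> continuous_on UNIV F \<and>
     (\<forall>c\<in>A. \<forall>d\<in>B. smooth_on (cmap c ` (cdom c \<inter> F -` cdom d)) (cmap d \<circ> F \<circ> cinv c))"

definition differential ::
  "('m, 'e::euclidean_space) chart set \<Rightarrow> ('b, 'f::euclidean_space) chart set \<Rightarrow>
   ('m \<Rightarrow> 'b) \<Rightarrow> 'm \<Rightarrow> 'e \<Rightarrow> 'f" where
  "differential A B F p =
     frechet_derivative (cmap (chart_at B (F p)) \<circ> F \<circ> cinv (chart_at A p)) (at (cmap (chart_at A p) p))"


section \<open>Riemannian metrics and the Levi-Civita connection\<close>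

text \<open>Throughout, sections are taken over arbitrary open sets \<open>U\<close>, not only over the whole manifold.
  All objects involved are local (tensors, connections, brackets), and every germ of a local section
  extends to a global one, so this agrees with quantifying over global sections.\<close>

definition riemannian_metric ::
  "('m::topological_space, 'e::euclidean_space) chart set \<Rightarrow> ('m \<Rightarrow> 'e \<Rightarrow> 'e \<Rightarrow> real) \<Rightarrow> bool" where
  "riemannian_metric A g \<longleftrightarrow>
     (\<forall>p. bilinear (g p) \<and> (\<forall>u v. g p u v = g p v u) \<and> (\<forall>v. v \<noteq> 0 \<longrightarrow> g p v v > 0)) \<and>
     (\<forall>U X Y. open U \<and> smooth_vf A U X \<and> smooth_vf A U Y \<longrightarrow> smooth_fun A U (\<lambda>p. g p (X p) (Y p)))"

definition riemannian_manifold ::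
  "('m::{t2_space,second_countable_topology}, 'e::euclidean_space) chart set \<Rightarrow>
   ('m \<Rightarrow> 'e \<Rightarrow> 'e \<Rightarrow> real) \<Rightarrow> bool" where
  "riemannian_manifold A g \<longleftrightarrow> smooth_atlas A \<and> riemannian_metric A g"

text \<open>\<open>nabla p v Y\<close> is the covariant derivative at \<open>p\<close> of \<open>Y\<close>, a vector field that is smooth near
  \<open>p\<close>, in the direction \<open>v\<close>.  It depends only on the germ of \<open>Y\<close> at \<open>p\<close>; the value is irrelevant if
  \<open>Y\<close> is not smooth near \<open>p\<close>.\<close>

type_synonym ('m, 'e) conn = "'m \<Rightarrow> 'e \<Rightarrow> ('m \<Rightarrow> 'e) \<Rightarrow> 'e"

definition cov :: "('m, 'e) conn \<Rightarrow> ('m \<Rightarrow> 'e) \<Rightarrow> ('m \<Rightarrow> 'e) \<Rightarrow> 'm \<Rightarrow> 'e" where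
  "cov nabla X Y p = nabla p (X p) Y"

definition affine_connection ::
  "('m::topological_space, 'e::euclidean_space) chart set \<Rightarrow> ('m, 'e) conn \<Rightarrow> bool" where
  "affine_connection A nabla \<longleftrightarrow>
     (\<forall>U X Y. open U \<and> smooth_vf A U X \<and> smooth_vf A U Y \<longrightarrow> smooth_vf A U (cov nabla X Y)) \<and>
     (\<forall>U Y p. open U \<and> smooth_vf A U Y \<and> p \<in> U \<longrightarrow> linear (\<lambda>v. nabla p v Y)) \<and>
     (\<forall>U Y Z p v. open U \<and> smooth_vf A U Y \<and> smooth_vf A U Z \<and> p \<in> U \<longrightarrow>
        nabla p v (\<lambda>q. Y q + Z q) = nabla p v Y + nabla p v Z) \<and>
     (\<forall>U f Y p v. open U \<and> smooth_fun A U f \<and> smooth_vf A U Y \<and> p \<in> U \<longrightarrow>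
        nabla p v (\<lambda>q. f q *\<^sub>R Y q) = dir_deriv A f p v *\<^sub>R Y p + f p *\<^sub>R nabla p v Y) \<and>
     (\<forall>U Y Z p v. open U \<and> smooth_vf A U Y \<and> p \<in> U \<and> (\<forall>q\<in>U. Z q = Y q) \<longrightarrow>
        nabla p v Z = nabla p v Y)"

definition levi_civita ::
  "('m::topological_space, 'e::euclidean_space) chart set \<Rightarrow> ('m \<Rightarrow> 'e \<Rightarrow> 'e \<Rightarrow> real) \<Rightarrow>
   ('m, 'e) conn \<Rightarrow> bool" where
  "levi_civita A g nabla \<longleftrightarrow> affine_connection A nabla \<and>
     (\<forall>U X Y p. open U \<and> smooth_vf A U X \<and> smooth_vf A U Y \<and> p \<in> U \<longrightarrow>
        cov nabla X Y p - cov nabla Y X p = lie_bracket A X Y p) \<and>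
     (\<forall>U X Y p v. open U \<and> smooth_vf A U X \<and> smooth_vf A U Y \<and> p \<in> U \<longrightarrow>
        dir_deriv A (\<lambda>q. g q (X q) (Y q)) p v = g p (nabla p v X) (Y p) + g p (X p) (nabla p v Y))"

definition curvature ::
  "('m, 'e::euclidean_space) chart set \<Rightarrow> ('m, 'e) conn \<Rightarrow>
   ('m \<Rightarrow> 'e) \<Rightarrow> ('m \<Rightarrow> 'e) \<Rightarrow> ('m \<Rightarrow> 'e) \<Rightarrow> 'm \<Rightarrow> 'e" where
  "curvature A nabla X Y Z p =
     cov nabla X (cov nabla Y Z) p - cov nabla Y (cov nabla X Z) p - cov nabla (lie_bracket A X Y) Z p"

text \<open>Sectional curvature of the plane spanned by \<open>X p\<close> and \<open>Y p\<close>.\<close>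

definition sectional_curvature ::
  "('m, 'e::euclidean_space) chart set \<Rightarrow> ('m \<Rightarrow> 'e \<Rightarrow> 'e \<Rightarrow> real) \<Rightarrow> ('m, 'e) conn \<Rightarrow>
   ('m \<Rightarrow> 'e) \<Rightarrow> ('m \<Rightarrow> 'e) \<Rightarrow> 'm \<Rightarrow> real" where
  "sectional_curvature A g nabla X Y p = g p (curvature A nabla X Y Y p) (X p) /
     (g p (X p) (X p) * g p (Y p) (Y p) - (g p (X p) (Y p))\<^sup>2)"


section \<open>Nearly Kaehler manifolds\<close>

definition almost_hermitian ::
  "('m::{t2_space,second_countable_topology}, 'e::euclidean_space) chart set \<Rightarrow>
   ('m \<Rightarrow> 'e \<Rightarrow> 'e \<Rightarrow> real) \<Rightarrow> ('m \<Rightarrow> 'e \<Rightarrow> 'e) \<Rightarrow> bool" where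
  "almost_hermitian A g J \<longleftrightarrow> riemannian_manifold A g \<and>
     (\<forall>p. linear (J p)) \<and>
     (\<forall>U X. open U \<and> smooth_vf A U X \<longrightarrow> smooth_vf A U (\<lambda>p. J p (X p))) \<and>
     (\<forall>p v. J p (J p v) = - v) \<and>
     (\<forall>p u v. g p (J p u) (J p v) = g p u v)"

text \<open>\<open>(\<nabla>\<^sub>X J) Y = \<nabla>\<^sub>X (J Y) - J (\<nabla>\<^sub>X Y)\<close>\<close>

definition cov_J ::
  "('m, 'e::euclidean_space) conn \<Rightarrow> ('m \<Rightarrow> 'e \<Rightarrow> 'e) \<Rightarrow> ('m \<Rightarrow> 'e) \<Rightarrow> ('m \<Rightarrow> 'e) \<Rightarrow> 'm \<Rightarrow> 'e" where
  "cov_J nabla J X Y p = cov nabla X (\<lambda>q. J q (Y q)) p - J p (cov nabla X Y p)"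

definition nearly_kaehler ::
  "('m::{t2_space,second_countable_topology}, 'e::euclidean_space) chart set \<Rightarrow>
   ('m \<Rightarrow> 'e \<Rightarrow> 'e \<Rightarrow> real) \<Rightarrow> ('m \<Rightarrow> 'e \<Rightarrow> 'e) \<Rightarrow> ('m, 'e) conn \<Rightarrow> bool" where
  "nearly_kaehler A g J nabla \<longleftrightarrow> almost_hermitian A g J \<and> levi_civita A g nabla \<and>
     (\<forall>U X Y p. open U \<and> smooth_vf A U X \<and> smooth_vf A U Y \<and> p \<in> U \<longrightarrow>
        cov_J nabla J X Y p + cov_J nabla J Y X p = 0)"

definition constant_holomorphic_sectional_curvature ::
  "('m::topological_space, 'e::euclidean_space) chart set \<Rightarrow> ('m \<Rightarrow> 'e \<Rightarrow> 'e \<Rightarrow> real) \<Rightarrow>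
   ('m \<Rightarrow> 'e \<Rightarrow> 'e) \<Rightarrow> ('m, 'e) conn \<Rightarrow> real \<Rightarrow> bool" where
  "constant_holomorphic_sectional_curvature A g J nabla c \<longleftrightarrow>
     (\<forall>U X p. open U \<and> smooth_vf A U X \<and> p \<in> U \<and> X p \<noteq> 0 \<longrightarrow>
        sectional_curvature A g nabla X (\<lambda>q. J q (X q)) p = c)"

definition constant_type ::
  "('m::topological_space, 'e::euclidean_space) chart set \<Rightarrow> ('m \<Rightarrow> 'e \<Rightarrow> 'e \<Rightarrow> real) \<Rightarrow>
   ('m \<Rightarrow> 'e \<Rightarrow> 'e) \<Rightarrow> ('m, 'e) conn \<Rightarrow> real \<Rightarrow> bool" where
  "constant_type A g J nabla \<alpha> \<longleftrightarrow>
     (\<forall>U X Y p. open U \<and> smooth_vf A U X \<and> smooth_vf A U Y \<and> p \<in> U \<longrightarrow>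
        g p (cov_J nabla J X Y p) (cov_J nabla J X Y p) =
          \<alpha> * (g p (X p) (X p) * g p (Y p) (Y p) - (g p (X p) (Y p))\<^sup>2 - (g p (X p) (J p (Y p)))\<^sup>2))"


section \<open>Distributions\<close>

definition distribution ::
  "('m::topological_space, 'e::euclidean_space) chart set \<Rightarrow> ('m \<Rightarrow> 'e set) \<Rightarrow> bool" where
  "distribution A D \<longleftrightarrow>
     (\<exists>k. \<forall>p. \<exists>U (X::nat \<Rightarrow> 'm \<Rightarrow> 'e). open U \<and> p \<in> U \<and> (\<forall>i<k. smooth_vf A U (X i)) \<and>
        (\<forall>q\<in>U. inj_on (\<lambda>i. X i q) {..<k} \<and> independent ((\<lambda>i. X i q) ` {..<k}) \<and>
               D q = span ((\<lambda>i. X i q) ` {..<k})))"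

text \<open>Through every point \<open>p\<close> there is an integral manifold.  Locally it is an embedded submanifold,
  i.e. a slice \<open>{q \<in> cdom \<psi>. cmap \<psi> q - cmap \<psi> p \<in> S}\<close> of a chart \<open>\<psi>\<close> of the smooth structure
  (\<open>S\<close> a linear subspace); its tangent space at \<open>q\<close> corresponds to \<open>S\<close> under the differential
  of \<open>cmap \<psi>\<close>, and has to be \<open>D q\<close>.\<close>

definition integrable_distribution ::
  "('m::{t2_space,second_countable_topology}, 'e::euclidean_space) chart set \<Rightarrow>
   ('m \<Rightarrow> 'e set) \<Rightarrow> bool" where
  "integrable_distribution A D \<longleftrightarrow>
     (\<forall>p. \<exists>\<psi> S. smooth_atlas (insert \<psi> A) \<and> p \<in> cdom \<psi> \<and> subspace S \<and>
        (\<forall>q\<in>cdom \<psi>. cmap \<psi> q - cmap \<psi> p \<in> S \<longrightarrow> tchart A \<psi> q ` D q = S))"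


section \<open>Generic Riemannian submersions\<close>

definition orth :: "('m \<Rightarrow> 'e \<Rightarrow> 'e \<Rightarrow> real) \<Rightarrow> ('m \<Rightarrow> 'e set) \<Rightarrow> 'm \<Rightarrow> 'e set" where
  "orth g V p = {v. \<forall>u\<in>V p. g p u v = 0}"

definition vertical ::
  "('m, 'e::euclidean_space) chart set \<Rightarrow> ('b, 'f::euclidean_space) chart set \<Rightarrow>
   ('m \<Rightarrow> 'b) \<Rightarrow> 'm \<Rightarrow> 'e set" where
  "vertical A B F p = {v. differential A B F p v = 0}"

definition riemannian_submersion ::
  "('m::{t2_space,second_countable_topology}, 'e::euclidean_space) chart set \<Rightarrow>
   ('m \<Rightarrow> 'e \<Rightarrow> 'e \<Rightarrow> real) \<Rightarrow>
   ('b::{t2_space,second_countable_topology}, 'f::euclidean_space) chart set \<Rightarrow>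
   ('b \<Rightarrow> 'f \<Rightarrow> 'f \<Rightarrow> real) \<Rightarrow> ('m \<Rightarrow> 'b) \<Rightarrow> bool" where
  "riemannian_submersion A g B h F \<longleftrightarrow>
     riemannian_manifold A g \<and> riemannian_manifold B h \<and> DIM('e) > DIM('f) \<and>
     smooth_map A B F \<and> (\<forall>p. surj (differential A B F p)) \<and>
     (\<forall>p. \<forall>u\<in>orth g (vertical A B F) p. \<forall>v\<in>orth g (vertical A B F) p.
        h (F p) (differential A B F p u) (differential A B F p v) = g p u v)"

definition orth_in_vertical ::
  "('m, 'e::euclidean_space) chart set \<Rightarrow> ('m \<Rightarrow> 'e \<Rightarrow> 'e \<Rightarrow> real) \<Rightarrow>
   ('b, 'f::euclidean_space) chart set \<Rightarrow> ('m \<Rightarrow> 'b) \<Rightarrow> ('m \<Rightarrow> 'e set) \<Rightarrow> 'm \<Rightarrow> 'e set" where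
  "orth_in_vertical A g B F D p = vertical A B F p \<inter> orth g D p"

definition generic_riemannian_submersion ::
  "('m::{t2_space,second_countable_topology}, 'e::euclidean_space) chart set \<Rightarrow>
   ('m \<Rightarrow> 'e \<Rightarrow> 'e \<Rightarrow> real) \<Rightarrow> ('m \<Rightarrow> 'e \<Rightarrow> 'e) \<Rightarrow>
   ('b::{t2_space,second_countable_topology}, 'f::euclidean_space) chart set \<Rightarrow>
   ('b \<Rightarrow> 'f \<Rightarrow> 'f \<Rightarrow> real) \<Rightarrow> ('m \<Rightarrow> 'b) \<Rightarrow> ('m \<Rightarrow> 'e set) \<Rightarrow> bool" where
  "generic_riemannian_submersion A g J B h F D \<longleftrightarrow>
     riemannian_submersion A g B h F \<and> distribution A D \<and>
     (\<forall>p. D p \<subseteq> vertical A B F p \<and>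
          vertical A B F p = {u + w |u w. u \<in> D p \<and> w \<in> orth_in_vertical A g B F D p} \<and>
          D p \<inter> orth_in_vertical A g B F D p = {0} \<and>
          J p ` D p = D p \<and>
          orth_in_vertical A g B F D p \<inter> J p ` orth_in_vertical A g B F D p = {0})"


section \<open>O'Neill's tensor and totally umbilical fibers\<close>

definition vproj ::
  "('m, 'e::euclidean_space) chart set \<Rightarrow> ('m \<Rightarrow> 'e \<Rightarrow> 'e \<Rightarrow> real) \<Rightarrow>
   ('b, 'f::euclidean_space) chart set \<Rightarrow> ('m \<Rightarrow> 'b) \<Rightarrow> 'm \<Rightarrow> 'e \<Rightarrow> 'e" where
  "vproj A g B F p v =
     (THE u. u \<in> vertical A B F p \<and> v - u \<in> orth g (vertical A B F) p)"

definition hproj ::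
  "('m, 'e::euclidean_space) chart set \<Rightarrow> ('m \<Rightarrow> 'e \<Rightarrow> 'e \<Rightarrow> real) \<Rightarrow>
   ('b, 'f::euclidean_space) chart set \<Rightarrow> ('m \<Rightarrow> 'b) \<Rightarrow> 'm \<Rightarrow> 'e \<Rightarrow> 'e" where
  "hproj A g B F p v = v - vproj A g B F p v"

definition oneill_T ::
  "('m, 'e::euclidean_space) chart set \<Rightarrow> ('m \<Rightarrow> 'e \<Rightarrow> 'e \<Rightarrow> real) \<Rightarrow> ('m, 'e) conn \<Rightarrow>
   ('b, 'f::euclidean_space) chart set \<Rightarrow> ('m \<Rightarrow> 'b) \<Rightarrow>
   ('m \<Rightarrow> 'e) \<Rightarrow> ('m \<Rightarrow> 'e) \<Rightarrow> 'm \<Rightarrow> 'e" where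
  "oneill_T A g nabla B F E G p =
     (let vE = (\<lambda>q. vproj A g B F q (E q)) in
        hproj A g B F p (cov nabla vE (\<lambda>q. vproj A g B F q (G q)) p) +
        vproj A g B F p (cov nabla vE (\<lambda>q. hproj A g B F q (G q)) p))"

definition vertical_vf ::
  "('m, 'e::euclidean_space) chart set \<Rightarrow> ('b, 'f::euclidean_space) chart set \<Rightarrow>
   ('m \<Rightarrow> 'b) \<Rightarrow> 'm set \<Rightarrow> ('m \<Rightarrow> 'e) \<Rightarrow> bool" where
  "vertical_vf A B F U X \<longleftrightarrow> smooth_vf A U X \<and> (\<forall>p\<in>U. X p \<in> vertical A B F p)"

text \<open>\<open>H = (1/r) \<Sum>\<^sub>i T\<^bsub>e\<^sub>i\<^esub> e\<^sub>i\<close> for all local orthonormal frames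
  \<open>e\<^sub>0, \<dots>, e\<^sub>r\<^sub>-\<^sub>1\<close> of the vertical distribution, with \<open>r\<close> the dimension of the fibers.\<close>

definition mean_curvature_field ::
  "('m::topological_space, 'e::euclidean_space) chart set \<Rightarrow> ('m \<Rightarrow> 'e \<Rightarrow> 'e \<Rightarrow> real) \<Rightarrow>
   ('m, 'e) conn \<Rightarrow> ('b, 'f::euclidean_space) chart set \<Rightarrow> ('m \<Rightarrow> 'b) \<Rightarrow> ('m \<Rightarrow> 'e) \<Rightarrow> bool" where
  "mean_curvature_field A g nabla B F H \<longleftrightarrow> smooth_vf A UNIV H \<and>
     (let r = DIM('e) - DIM('f) in
       \<forall>U (E::nat \<Rightarrow> 'm \<Rightarrow> 'e). open U \<and> (\<forall>i<r. vertical_vf A B F U (E i)) \<and>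
          (\<forall>p\<in>U. \<forall>i<r. \<forall>j<r. g p (E i p) (E j p) = (if i = j then 1 else 0)) \<longrightarrow>
          (\<forall>p\<in>U. H p = (1 / real r) *\<^sub>R (\<Sum>i<r. oneill_T A g nabla B F (E i) (E i) p)))"

definition totally_umbilical_fibers ::
  "('m::topological_space, 'e::euclidean_space) chart set \<Rightarrow> ('m \<Rightarrow> 'e \<Rightarrow> 'e \<Rightarrow> real) \<Rightarrow>
   ('m, 'e) conn \<Rightarrow> ('b, 'f::euclidean_space) chart set \<Rightarrow> ('m \<Rightarrow> 'b) \<Rightarrow> bool" where
  "totally_umbilical_fibers A g nabla B F \<longleftrightarrow>
     (\<exists>H. mean_curvature_field A g nabla B F H \<and>
        (\<forall>W U V p. open W \<and> vertical_vf A B F W U \<and> vertical_vf A B F W V \<and> p \<in> W \<longrightarrow>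
           oneill_T A g nabla B F U V p = g p (U p) (V p) *\<^sub>R H p))"

end

theory Submission
  imports Defs "HOL-Library.Function_Algebras"
begin

text \<open>
  For a nearly Kaehler manifold of constant holomorphic sectional
  curvature \<open>c\<close> and constant type \<open>\<alpha>\<close>, Gray's identity and polarization give
  \<open>2 g(R(X,JX)JY,N) = (c - \<alpha>) g(X,X) g(Y,N)\<close> whenever \<open>Y\<close> and \<open>N\<close> are orthogonal to \<open>X\<close> and \<open>JX\<close>.
  For a local section \<open>X\<close> of \<open>D\<close> and a local section \<open>Z\<close> of its complement in the vertical
  distribution, umbilicity makes \<open>R(X,JX)Z\<close> vertical (Codazzi).  Taking \<open>Y = - JZ\<close> and \<open>N\<close> the
  horizontal part of \<open>JZ\<close>, which is nonzero because the complement is purely real, yields \<open>c = \<alpha>\<close>.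
\<close>

text \<open>Curvature is evaluated on vector fields, and the Codazzi step differentiates the
  relations \<open>g(X,Z) = 0\<close> and \<open>g(JX,Z) = 0\<close>. Orthogonality at one point is
  therefore not enough: \<open>Z\<close> must have a prescribed nonzero value and stay vertical and
  orthogonal to all of \<open>D\<close> on a neighbourhood. It is found by solving finitely many
  independent linear equations with smooth coefficients, on an open set that shrinks as needed. In
  contrast, \<open>Y\<close> and \<open>N\<close> have to be orthogonal to \<open>X\<close> and
  \<open>JX\<close> only at the chosen point, so any extension of the horizontal vector serves as
  \<open>N\<close>. Umbilicity enters as follows: the horizontal part of \<open>nabla_U V\<close> is
  \<open>g(U,V) H\<close>, so the derivative of \<open>Z\<close> along a vertical field orthogonal
  to it is again vertical and can be differentiated a second time. On the algebraic side, Gray's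
  identity says that the square of the norm of \<open>(nabla_X J) Y\<close> is
  \<open>R(X,Y,JX,JY) - R(X,Y,X,Y)\<close>. Constant type turns it into a polynomial in
  \<open>g\<close> and \<open>J\<close>, so that the polarization argument known from Kaehler
  geometry survives with a correction proportional to \<alpha>.\<close>

section \<open>Calculus of smooth functions on open sets\<close>

text \<open>On an open set equal values mean equal germs, hence equal derivatives. This makes the
  arbitrary values of \<open>cinv\<close> and of coordinate maps outside their domains
  harmless.\<close>

lemma Ck_on_cong:
  assumes "open S" and "\<And>x. x \<in> S \<Longrightarrow> f x = g x"
  shows "Ck_on k S f \<longleftrightarrow> Ck_on k S g"
proof -
  \<comment> \<open>One implication is proved for all pairs of functions; exchanging the two gives
    the converse.\<close>
  have "Ck_on k S g" if "open S" "\<forall>x\<in>S. f x = g x" "Ck_on k S f"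
    for f g :: "'a \<Rightarrow> 'b"
    using that
  proof (induction k arbitrary: f g)
    case 0
    then show ?case by (simp cong: continuous_on_cong)
  next
    case (Suc k)
    have d: "f differentiable (at x)" if "x \<in> S" for x using Suc.prems that by simp
    have d': "g differentiable (at x)" if "x \<in> S" for x
      using d[OF that] Suc.prems(1,2) that has_derivative_transform_within_open[of f _ x UNIV S g]
      unfolding differentiable_def by blast
    have "frechet_derivative f (at x) v = frechet_derivative g (at x) v" if "x \<in> S" for x v
      using frechet_derivative_transform_within_open[OF d[OF that] Suc.prems(1) that, of g] Suc.prems(2)
      by simp
    then have "Ck_on k S (\<lambda>x. frechet_derivative g (at x) v)" for v
      using Suc.IH[of "\<lambda>x. frechet_derivative f (at x) v" "\<lambda>x. frechet_derivative g (at x) v"] Suc.prems by simp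
    then show ?case using d' by simp
  qed
  from this[of f g] this[of g f] assms show ?thesis by auto
qed

lemma Ck_on_subset: "Ck_on k S f \<Longrightarrow> T \<subseteq> S \<Longrightarrow> Ck_on k T f"
  by (induction k arbitrary: f) (auto intro: continuous_on_subset)

lemma Ck_on_Suc_imp: "Ck_on (Suc k) S f \<Longrightarrow> Ck_on k S f"
proof (induction k arbitrary: f)
  case 0
  then show ?case
    by (auto intro!: continuous_at_imp_continuous_on differentiable_imp_continuous_within)
next
  case (Suc k)
  then show ?case by simp
qed

lemma Ck_on_const: "Ck_on k S (\<lambda>x. a)"
  by (induction k arbitrary: a) auto

text \<open>Any known derivative \<open>f'\<close> may stand in for the chosen
  \<open>frechet_derivative\<close>, so each closure property below is an induction on
  \<open>k\<close> whose step is a differentiation rule.\<close>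

lemma Ck_on_SucI:
  assumes "open S" and hd: "\<And>x. x \<in> S \<Longrightarrow> (f has_derivative f' x) (at x)"
    and "\<And>v. Ck_on k S (\<lambda>x. f' x v)"
  shows "Ck_on (Suc k) S f"
proof -
  have "Ck_on k S (\<lambda>x. frechet_derivative f (at x) v)" for v
    using assms(3)[of v] frechet_derivative_at[OF hd]
    by (subst Ck_on_cong[OF \<open>open S\<close>, of _ "\<lambda>x. f' x v"]) auto
  then show ?thesis using differentiableI[OF hd] by simp
qed

lemma Ck_on_SucD:
  assumes "Ck_on (Suc k) S f"
  shows "x \<in> S \<Longrightarrow> (f has_derivative frechet_derivative f (at x)) (at x)"
    and "Ck_on k S (\<lambda>x. frechet_derivative f (at x) v)"
  using assms by (simp_all add: frechet_derivative_works[symmetric])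

lemma Ck_on_bounded_linear_comp:
  assumes "bounded_linear h" and "open S" and "Ck_on k S f"
  shows "Ck_on k S (\<lambda>x. h (f x))"
  using assms(3)
proof (induction k arbitrary: f)
  case 0
  then show ?case using assms(1) by (simp add: bounded_linear.continuous_on)
next
  case (Suc k)
  show ?case
    by (rule Ck_on_SucI[OF \<open>open S\<close> bounded_linear.has_derivative[OF assms(1) Ck_on_SucD(1)[OF Suc.prems]]])
      (auto intro: Suc.IH Ck_on_SucD(2)[OF Suc.prems])
qed

lemma Ck_on_add:
  assumes "open S" and "Ck_on k S f" and "Ck_on k S g"
  shows "Ck_on k S (\<lambda>x. f x + g x)"
  using assms(2,3)
proof (induction k arbitrary: f g)
  case 0
  then show ?case by (simp add: continuous_on_add)
next
  case (Suc k)
  show ?case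
    by (rule Ck_on_SucI[OF \<open>open S\<close> has_derivative_add[OF Ck_on_SucD(1)[OF Suc.prems(1)] Ck_on_SucD(1)[OF Suc.prems(2)]]])
      (auto intro: Suc.IH Ck_on_SucD(2)[OF Suc.prems(1)] Ck_on_SucD(2)[OF Suc.prems(2)])
qed

lemma Ck_on_sum:
  assumes "open S" and "\<And>i. i \<in> I \<Longrightarrow> Ck_on k S (f i)"
  shows "Ck_on k S (\<lambda>x. \<Sum>i\<in>I. f i x)"
  using assms(2)
  by (induction I rule: infinite_finite_induct) (auto intro: Ck_on_const Ck_on_add[OF assms(1)])

lemma Ck_on_bilinear:
  assumes b: "bounded_bilinear b" and "open S" and "Ck_on k S f" and "Ck_on k S g"
  shows "Ck_on k S (\<lambda>x. b (f x) (g x))"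
  using assms(3,4)
proof (induction k arbitrary: f g)
  case 0
  then show ?case by (simp add: bounded_bilinear.continuous_on[OF b])
next
  case (Suc k)
  show ?case
    by (rule Ck_on_SucI[OF \<open>open S\<close> bounded_bilinear.FDERIV[OF b Ck_on_SucD(1)[OF Suc.prems(1)] Ck_on_SucD(1)[OF Suc.prems(2)]]])
      (assumption | intro Ck_on_add[OF \<open>open S\<close>] Suc.IH Ck_on_SucD(2)[OF Suc.prems(1)] Ck_on_SucD(2)[OF Suc.prems(2)]
        Ck_on_Suc_imp[OF Suc.prems(1)] Ck_on_Suc_imp[OF Suc.prems(2)])+
qed

text \<open>\<open>Ck_on\<close> speaks of derivatives in a fixed direction only; this expansion
  handles directions that vary with the point.\<close>

lemma frechet_derivative_Basis_sum:
  assumes "f differentiable (at x)"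
  shows "frechet_derivative f (at x) v = (\<Sum>i\<in>Basis. (v \<bullet> i) *\<^sub>R frechet_derivative f (at x) i)"
proof -
  interpret linear "frechet_derivative f (at x)" using assms by (rule linear_frechet_derivative)
  show ?thesis
    by (subst euclidean_representation[of v, symmetric], subst sum) (simp add: scale)
qed

lemma Ck_on_inner_left: "open S \<Longrightarrow> Ck_on k S f \<Longrightarrow> Ck_on k S (\<lambda>x. f x \<bullet> v)"
  by (rule Ck_on_bounded_linear_comp[OF bounded_linear_inner_left])

text \<open>The chain rule differentiates \<open>f\<close> in a direction depending on the point.
  After basis expansion only products remain, of components of the derivative of \<open>g\<close>
  and of derivatives of \<open>f\<close> in fixed directions composed with \<open>g\<close>; the
  latter are covered by the induction hypothesis.\<close>

lemma Ck_on_compose: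
  assumes "open S" "open T" and "Ck_on k T f" "Ck_on k S g" "g ` S \<subseteq> T"
  shows "Ck_on k S (\<lambda>x. f (g x))"
  using assms(3,4)
proof (induction k arbitrary: f)
  case 0
  then show ?case using assms(5) by (auto intro: continuous_on_compose2)
next
  case (Suc k)
  have gT: "g x \<in> T" if "x \<in> S" for x using assms(5) that by blast
  have "((\<lambda>x. f (g x)) has_derivative
      (\<lambda>v. \<Sum>i\<in>Basis. (frechet_derivative g (at x) v \<bullet> i) *\<^sub>R frechet_derivative f (at (g x)) i)) (at x)"
    if "x \<in> S" for x
    using has_derivative_compose[OF Ck_on_SucD(1)[OF Suc.prems(2) that] Ck_on_SucD(1)[OF Suc.prems(1) gT[OF that]]]
    unfolding frechet_derivative_Basis_sum[OF differentiableI[OF Ck_on_SucD(1)[OF Suc.prems(1) gT[OF that]]],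
        of "frechet_derivative g (at x) _"] .
  moreover have "Ck_on k S (\<lambda>x. \<Sum>i\<in>Basis. (frechet_derivative g (at x) v \<bullet> i) *\<^sub>R frechet_derivative f (at (g x)) i)" for v
    by (rule Ck_on_sum[OF \<open>open S\<close>], rule Ck_on_bilinear[OF bounded_bilinear_scaleR \<open>open S\<close>])
      (rule Ck_on_inner_left[OF \<open>open S\<close> Ck_on_SucD(2)[OF Suc.prems(2)]],
       rule Suc.IH[OF Ck_on_SucD(2)[OF Suc.prems(1)] Ck_on_Suc_imp[OF Suc.prems(2)]])
  ultimately show ?case by (rule Ck_on_SucI[OF \<open>open S\<close>])
qed

lemma Ck_on_inverse:
  fixes f :: "'a::euclidean_space \<Rightarrow> real"
  assumes "open S" and "Ck_on k S f" and nz: "\<And>x. x \<in> S \<Longrightarrow> f x \<noteq> 0"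
  shows "Ck_on k S (\<lambda>x. inverse (f x))"
  using assms(2)
proof (induction k)
  case 0
  then show ?case using nz by (auto intro: continuous_on_inverse)
next
  case (Suc k)
  have "Ck_on k S (\<lambda>x. - (inverse (f x) * frechet_derivative f (at x) v * inverse (f x)))" for v
    by (intro Ck_on_bounded_linear_comp[OF bounded_linear_minus[OF bounded_linear_ident] \<open>open S\<close>]
        Ck_on_bilinear[OF bounded_bilinear_mult \<open>open S\<close>] Suc.IH Ck_on_SucD(2)[OF Suc.prems] Ck_on_Suc_imp[OF Suc.prems])
  then show ?case
    by (intro Ck_on_SucI[OF \<open>open S\<close> Deriv.has_derivative_inverse[OF nz Ck_on_SucD(1)[OF Suc.prems]]])
qed

section \<open>Smooth functions: transfer of the results for each finite order\<close>

lemma smooth_on_cong: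
  "open S \<Longrightarrow> (\<And>x. x \<in> S \<Longrightarrow> f x = g x) \<Longrightarrow> smooth_on S f \<longleftrightarrow> smooth_on S g"
  using Ck_on_cong[of S f g] by (auto simp: smooth_on_def)

lemma smooth_on_subset: "smooth_on S f \<Longrightarrow> T \<subseteq> S \<Longrightarrow> smooth_on T f"
  unfolding smooth_on_def using Ck_on_subset by blast

lemma smooth_on_const: "smooth_on S (\<lambda>x. a)"
  by (simp add: smooth_on_def Ck_on_const)

lemma smooth_on_add: "open S \<Longrightarrow> smooth_on S f \<Longrightarrow> smooth_on S g \<Longrightarrow> smooth_on S (\<lambda>x. f x + g x)"
  by (simp add: smooth_on_def Ck_on_add)

lemma smooth_on_sum: "open S \<Longrightarrow> (\<And>i. i \<in> I \<Longrightarrow> smooth_on S (f i)) \<Longrightarrow> smooth_on S (\<lambda>x. \<Sum>i\<in>I. f i x)"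
  by (simp add: smooth_on_def Ck_on_sum)

lemma smooth_on_bilinear:
  "bounded_bilinear b \<Longrightarrow> open S \<Longrightarrow> smooth_on S f \<Longrightarrow> smooth_on S g \<Longrightarrow> smooth_on S (\<lambda>x. b (f x) (g x))"
  by (simp add: smooth_on_def Ck_on_bilinear)

lemma smooth_on_bounded_linear_comp:
  "bounded_linear h \<Longrightarrow> open S \<Longrightarrow> smooth_on S f \<Longrightarrow> smooth_on S (\<lambda>x. h (f x))"
  by (simp add: smooth_on_def Ck_on_bounded_linear_comp)

lemma smooth_on_compose:
  "open S \<Longrightarrow> open T \<Longrightarrow> smooth_on T f \<Longrightarrow> smooth_on S g \<Longrightarrow> g ` S \<subseteq> T \<Longrightarrow> smooth_on S (\<lambda>x. f (g x))"
  using Ck_on_compose[of S T _ f g] by (simp add: smooth_on_def)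

lemma smooth_on_inverse:
  fixes f :: "'a::euclidean_space \<Rightarrow> real"
  shows "open S \<Longrightarrow> smooth_on S f \<Longrightarrow> (\<And>x. x \<in> S \<Longrightarrow> f x \<noteq> 0) \<Longrightarrow> smooth_on S (\<lambda>x. inverse (f x))"
  by (simp add: smooth_on_def Ck_on_inverse)

lemma smooth_on_imp_Ck_on: "smooth_on S f \<Longrightarrow> Ck_on k S f"
  by (simp add: smooth_on_def)

lemma smooth_on_imp_continuous_on: "smooth_on S f \<Longrightarrow> continuous_on S f"
  using smooth_on_imp_Ck_on[of S f 0] by simp

lemma smooth_on_imp_differentiable: "smooth_on S f \<Longrightarrow> x \<in> S \<Longrightarrow> f differentiable (at x)"
  using smooth_on_imp_Ck_on[of S f "Suc 0"] by simp

lemma smooth_on_imp_has_derivative: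
  "smooth_on S f \<Longrightarrow> x \<in> S \<Longrightarrow> (f has_derivative frechet_derivative f (at x)) (at x)"
  by (rule Ck_on_SucD(1)[OF smooth_on_imp_Ck_on])

lemma smooth_on_frechet_derivative: "smooth_on S f \<Longrightarrow> smooth_on S (\<lambda>x. frechet_derivative f (at x) v)"
  unfolding smooth_on_def[of S "\<lambda>x. frechet_derivative f (at x) v"]
  by (intro allI Ck_on_SucD(2) smooth_on_imp_Ck_on)

lemma smooth_on_frechet_derivative_apply:
  assumes "open S" "smooth_on S f" "smooth_on S X"
  shows "smooth_on S (\<lambda>x. frechet_derivative f (at x) (X x))"
proof -
  have "smooth_on S (\<lambda>x. \<Sum>i\<in>Basis. (X x \<bullet> i) *\<^sub>R frechet_derivative f (at x) i)"
    using assms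
    by (intro smooth_on_sum smooth_on_bilinear[OF bounded_bilinear_scaleR]
        smooth_on_bounded_linear_comp[OF bounded_linear_inner_left] smooth_on_frechet_derivative) auto
  then show ?thesis
    by (subst smooth_on_cong[OF assms(1)])
      (use frechet_derivative_Basis_sum smooth_on_imp_differentiable[OF assms(2)] in auto)
qed

text \<open>The mean value theorem is used twice: for the increment of \<open>f\<close> under
  translation by \<open>t v\<close>, as a function of the coordinate \<open>s\<close> along
  \<open>u\<close>, and then for the derivative \<open>Df\<close> along \<open>v\<close>. The second
  difference is symmetric in \<open>u\<close> and \<open>v\<close>, whereas the right-hand side
  singles out one order of differentiation.\<close>

lemma second_difference_mean_value:
  fixes f :: "'a::euclidean_space \<Rightarrow> real"
  assumes f: "smooth_on S f"
    and S: "\<And>s r. 0 \<le> s \<Longrightarrow> s \<le> t \<Longrightarrow> 0 \<le> r \<Longrightarrow> r \<le> t \<Longrightarrow> x + s *\<^sub>R u + r *\<^sub>R v \<in> S"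
    and t: "0 < t"
  shows "\<exists>s r. 0 < s \<and> s < t \<and> 0 < r \<and> r < t \<and>
    f (x + t *\<^sub>R u + t *\<^sub>R v) - f (x + t *\<^sub>R u) - f (x + t *\<^sub>R v) + f x =
      t * t * frechet_derivative (\<lambda>y. frechet_derivative f (at y) u) (at (x + s *\<^sub>R u + r *\<^sub>R v)) v"
proof -
  define Df where "Df y = frechet_derivative f (at y) u" for y
  have Df: "smooth_on S Df" unfolding Df_def by (rule smooth_on_frechet_derivative[OF f])
  have S': "x + s *\<^sub>R u \<in> S" if "0 \<le> s" "s \<le> t" for s using S[of s 0] that t by simp
  have l: "linear (frechet_derivative h (at y))" if "smooth_on S h" "y \<in> S" for h :: "'a \<Rightarrow> real" and y
    using that smooth_on_imp_differentiable linear_frechet_derivative by blast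
  have drv: "((\<lambda>s. h (y + s *\<^sub>R w)) has_derivative (\<lambda>z. z * frechet_derivative h (at (y + s *\<^sub>R w)) w)) (at s)"
    if h: "smooth_on S h" and y: "y + s *\<^sub>R w \<in> S" for h :: "'a \<Rightarrow> real" and y w s
  proof -
    have "((\<lambda>s. h (y + s *\<^sub>R w)) has_derivative (\<lambda>z. frechet_derivative h (at (y + s *\<^sub>R w)) (z *\<^sub>R w))) (at s)"
      by (rule has_derivative_compose[where f = "\<lambda>s. y + s *\<^sub>R w", OF _ smooth_on_imp_has_derivative[OF h y]])
        (auto intro!: derivative_eq_intros)
    then show ?thesis using linear_scale[OF l[OF h y]] by simp
  qed
  have "((\<lambda>s. f (x + t *\<^sub>R v + s *\<^sub>R u) - f (x + s *\<^sub>R u)) has_derivative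
      (\<lambda>z. z * Df (x + t *\<^sub>R v + s *\<^sub>R u) - z * Df (x + s *\<^sub>R u))) (at s within {0..t})"
    if "0 \<le> s" "s \<le> t" for s
  proof -
    have "x + t *\<^sub>R v + s *\<^sub>R u \<in> S" using S[of s t] that t by (simp add: add_ac)
    from drv[OF f this] drv[OF f S'[OF that]] show ?thesis
      unfolding Df_def by (rule has_derivative_at_withinI[OF has_derivative_diff])
  qed
  from mvt_simple[OF t this] obtain s where s: "s \<in> {0<..<t}"
    and "f (x + t *\<^sub>R v + t *\<^sub>R u) - f (x + t *\<^sub>R u) - (f (x + t *\<^sub>R v + 0 *\<^sub>R u) - f (x + 0 *\<^sub>R u))
      = (t - 0) * Df (x + t *\<^sub>R v + s *\<^sub>R u) - (t - 0) * Df (x + s *\<^sub>R u)"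
    by (rule bexE)
  then have e1: "f (x + t *\<^sub>R u + t *\<^sub>R v) - f (x + t *\<^sub>R u) - f (x + t *\<^sub>R v) + f x
      = t * (Df (x + s *\<^sub>R u + t *\<^sub>R v) - Df (x + s *\<^sub>R u))"
    by (simp add: algebra_simps)
  have "((\<lambda>r. Df (x + s *\<^sub>R u + r *\<^sub>R v)) has_derivative
      (\<lambda>z. z * frechet_derivative Df (at (x + s *\<^sub>R u + r *\<^sub>R v)) v)) (at r within {0..t})"
    if "0 \<le> r" "r \<le> t" for r
    using S[of s r] s that by (intro has_derivative_at_withinI[OF drv[OF Df]]) auto
  from mvt_simple[OF t this] obtain r where r: "r \<in> {0<..<t}"
    and "Df (x + s *\<^sub>R u + t *\<^sub>R v) - Df (x + s *\<^sub>R u + 0 *\<^sub>R v)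
      = (t - 0) * frechet_derivative Df (at (x + s *\<^sub>R u + r *\<^sub>R v)) v"
    by (rule bexE)
  then have e2: "Df (x + s *\<^sub>R u + t *\<^sub>R v) - Df (x + s *\<^sub>R u)
      = t * frechet_derivative Df (at (x + s *\<^sub>R u + r *\<^sub>R v)) v" by simp
  show ?thesis using s r e2 unfolding e1 Df_def[symmetric]
    by - (rule exI[of _ s], rule exI[of _ r], simp)
qed

text \<open>Both mixed derivatives express the same second difference, each at some point of a small
  parallelogram. By continuity their values at \<open>x\<close> agree when the parallelogram
  shrinks.\<close>

lemma frechet_derivative_symmetric:
  fixes f :: "'a::euclidean_space \<Rightarrow> real"
  assumes "open S" and f: "smooth_on S f" and x: "x \<in> S"
  shows "frechet_derivative (\<lambda>y. frechet_derivative f (at y) u) (at x) v =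
    frechet_derivative (\<lambda>y. frechet_derivative f (at y) v) (at x) u"
proof -
  define A where "A y = frechet_derivative (\<lambda>y. frechet_derivative f (at y) u) (at y) v" for y
  define B where "B y = frechet_derivative (\<lambda>y. frechet_derivative f (at y) v) (at y) u" for y
  have cA: "isCont A x" and cB: "isCont B x"
    using smooth_on_imp_continuous_on[OF smooth_on_frechet_derivative[OF smooth_on_frechet_derivative[OF f]]]
      \<open>open S\<close> x unfolding A_def[abs_def] B_def[abs_def] by (simp_all add: continuous_on_eq_continuous_at)
  obtain d where d: "0 < d" "ball x d \<subseteq> S" using \<open>open S\<close> x open_contains_ball by blast
  have "\<bar>A x - B x\<bar> < e" if "0 < e" for e
  proof -
    obtain a where a: "0 < a" "\<And>y. dist y x < a \<Longrightarrow> \<bar>A y - A x\<bar> < e/2"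
      using cA half_gt_zero[OF \<open>0 < e\<close>] unfolding continuous_at_eps_delta dist_real_def by blast
    obtain b where b: "0 < b" "\<And>y. dist y x < b \<Longrightarrow> \<bar>B y - B x\<bar> < e/2"
      using cB half_gt_zero[OF \<open>0 < e\<close>] unfolding continuous_at_eps_delta dist_real_def by blast
    define m where "m = min d (min a b)"
    \<comment> \<open>With this \<open>t\<close> the whole parallelogram spanned by
      \<open>t u\<close> and \<open>t v\<close> lies within distance \<open>m\<close> of
      \<open>x\<close>; the summand 1 keeps the denominator positive when \<open>u\<close> and
      \<open>v\<close> vanish.\<close>
    define t where "t = m / (norm u + norm v + 1)"
    have m: "0 < m" "m \<le> d" "m \<le> a" "m \<le> b" using d a b by (auto simp: m_def)
    have pos: "0 < norm u + norm v + 1" by (intro add_nonneg_pos) auto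
    have t: "0 < t" unfolding t_def using m pos by simp
    have near: "dist (x + s *\<^sub>R u + r *\<^sub>R v) x < m" if "0 \<le> s" "s \<le> t" "0 \<le> r" "r \<le> t" for s r
    proof -
      have "dist (x + s *\<^sub>R u + r *\<^sub>R v) x = norm (s *\<^sub>R u + r *\<^sub>R v)" by (simp add: dist_norm)
      also have "\<dots> \<le> s * norm u + r * norm v" using norm_triangle_ineq[of "s *\<^sub>R u" "r *\<^sub>R v"] that by simp
      also have "\<dots> \<le> t * norm u + t * norm v" using that by (intro add_mono mult_right_mono) auto
      also have "\<dots> < t * (norm u + norm v + 1)" using t by (simp add: algebra_simps)
      also have "\<dots> = m" unfolding t_def using pos by simp
      finally show ?thesis .
    qed
    have inS: "x + s *\<^sub>R u + r *\<^sub>R v \<in> S" if "0 \<le> s" "s \<le> t" "0 \<le> r" "r \<le> t" for s r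
      using near[OF that] m d by (auto simp: dist_commute subset_iff)
    obtain s r where sr: "0 < s" "s < t" "0 < r" "r < t" and 1:
      "f (x + t *\<^sub>R u + t *\<^sub>R v) - f (x + t *\<^sub>R u) - f (x + t *\<^sub>R v) + f x = t * t * A (x + s *\<^sub>R u + r *\<^sub>R v)"
      using second_difference_mean_value[OF f inS t] unfolding A_def by blast
    have inS': "x + s *\<^sub>R v + r *\<^sub>R u \<in> S" if "0 \<le> s" "s \<le> t" "0 \<le> r" "r \<le> t" for s r
      using inS[OF that(3,4,1,2)] by (simp add: add_ac)
    obtain s' r' where sr': "0 < s'" "s' < t" "0 < r'" "r' < t" and 2:
      "f (x + t *\<^sub>R v + t *\<^sub>R u) - f (x + t *\<^sub>R v) - f (x + t *\<^sub>R u) + f x = t * t * B (x + s' *\<^sub>R v + r' *\<^sub>R u)"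
      using second_difference_mean_value[OF f inS' t] unfolding B_def by blast
    have "t * t * A (x + s *\<^sub>R u + r *\<^sub>R v) = t * t * B (x + s' *\<^sub>R v + r' *\<^sub>R u)"
      using 1 2 by (simp add: algebra_simps)
    then have "A (x + s *\<^sub>R u + r *\<^sub>R v) = B (x + r' *\<^sub>R u + s' *\<^sub>R v)"
      using t by (simp add: add.commute add.left_commute)
    moreover have "\<bar>A (x + s *\<^sub>R u + r *\<^sub>R v) - A x\<bar> < e/2" using near[of s r] sr m by (intro a) auto
    moreover have "\<bar>B (x + r' *\<^sub>R u + s' *\<^sub>R v) - B x\<bar> < e/2" using near[of r' s'] sr' m by (intro b) auto
    ultimately show ?thesis by linarith
  qed
  \<comment> \<open>A positive gap would be smaller than itself.\<close>
  from this[of "\<bar>A x - B x\<bar>"] have "A x = B x" by (cases "A x = B x") auto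
  then show ?thesis by (simp add: A_def B_def)
qed

section \<open>Charts, functions and vector fields\<close>

lemma is_chart_cinv_cmap: "is_chart c \<Longrightarrow> q \<in> cdom c \<Longrightarrow> cinv c (cmap c q) = q"
  by (simp add: is_chart_def homeomorphism_def)

lemma is_chart_open_image:
  assumes c: "is_chart c" and U: "open U"
  shows "open (cmap c ` (U \<inter> cdom c))"
proof -
  have "cmap c ` (U \<inter> cdom c) = cinv c -` U \<inter> cmap c ` cdom c"
    using is_chart_cinv_cmap[OF c] by auto
  moreover have "continuous_on (cmap c ` cdom c) (cinv c)" "open (cmap c ` cdom c)"
    using c by (auto simp: is_chart_def homeomorphism_def)
  ultimately show ?thesis
    using U by (metis Int_commute continuous_on_open_vimage)
qed

locale smooth_manifold =
  fixes A :: "('m::{t2_space,second_countable_topology}, 'e::euclidean_space) chart set"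
  assumes atlas: "smooth_atlas A"
begin

lemma is_chart: "c \<in> A \<Longrightarrow> is_chart c"
  using atlas by (simp add: smooth_atlas_def)

lemma open_cdom: "c \<in> A \<Longrightarrow> open (cdom c)"
  using is_chart by (simp add: is_chart_def)

lemma cinv_cmap: "c \<in> A \<Longrightarrow> q \<in> cdom c \<Longrightarrow> cinv c (cmap c q) = q"
  using is_chart is_chart_cinv_cmap by blast

lemma open_image: "c \<in> A \<Longrightarrow> open U \<Longrightarrow> open (cmap c ` (U \<inter> cdom c))"
  using is_chart is_chart_open_image by blast

lemma chart_at: "chart_at A p \<in> A" "p \<in> cdom (chart_at A p)"
proof -
  have "\<exists>c. c \<in> A \<and> p \<in> cdom c"
    using atlas unfolding smooth_atlas_def by blast
  then have "chart_at A p \<in> A \<and> p \<in> cdom (chart_at A p)"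
    unfolding chart_at_def by (rule someI_ex)
  then show "chart_at A p \<in> A" "p \<in> cdom (chart_at A p)" by auto
qed

section \<open>Transition maps and change of chart\<close>

lemma smooth_transition:
  "c \<in> A \<Longrightarrow> d \<in> A \<Longrightarrow> smooth_on (cmap c ` (cdom c \<inter> cdom d)) (cmap d \<circ> cinv c)"
  using atlas by (simp add: smooth_atlas_def)

lemma open_overlap: "c \<in> A \<Longrightarrow> d \<in> A \<Longrightarrow> open (cmap c ` (cdom c \<inter> cdom d))"
  using open_image[of c "cdom d"] open_cdom[of d] by (simp add: Int_commute)

lemma differentiable_transition:
  "c \<in> A \<Longrightarrow> d \<in> A \<Longrightarrow> q \<in> cdom c \<Longrightarrow> q \<in> cdom d \<Longrightarrow> (cmap d \<circ> cinv c) differentiable (at (cmap c q))"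
  using smooth_on_imp_differentiable[OF smooth_transition] by blast

text \<open>The target is an arbitrary normed space so that one chain rule serves both for real
  functions (\<open>dir_deriv\<close>) and for coordinate maps (\<open>tchart\<close>).\<close>

lemma frechet_derivative_change_chart:
  fixes f :: "'m \<Rightarrow> 'z::real_normed_vector"
  assumes c: "c \<in> A" "q \<in> cdom c" and d: "d \<in> A" "q \<in> cdom d"
    and f: "(f \<circ> cinv d) differentiable (at (cmap d q))"
  shows "frechet_derivative (f \<circ> cinv c) (at (cmap c q)) v =
      frechet_derivative (f \<circ> cinv d) (at (cmap d q)) (frechet_derivative (cmap d \<circ> cinv c) (at (cmap c q)) v)"
proof -
  let ?t = "cmap d \<circ> cinv c"
  have t: "(?t has_derivative frechet_derivative ?t (at (cmap c q))) (at (cmap c q))"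
    using differentiable_transition[OF c(1) d(1) c(2) d(2)] by (simp add: frechet_derivative_works)
  have tq: "?t (cmap c q) = cmap d q" using c by (simp add: cinv_cmap)
  have "((f \<circ> cinv d) \<circ> ?t has_derivative
      frechet_derivative (f \<circ> cinv d) (at (cmap d q)) \<circ> frechet_derivative ?t (at (cmap c q))) (at (cmap c q))"
    using diff_chain_at[OF t] f tq by (simp add: frechet_derivative_works)
  moreover have "((f \<circ> cinv d) \<circ> ?t) x = (f \<circ> cinv c) x" if "x \<in> cmap c ` (cdom c \<inter> cdom d)" for x
    using that c d by (auto simp: cinv_cmap)
  ultimately have h: "(f \<circ> cinv c has_derivative
      frechet_derivative (f \<circ> cinv d) (at (cmap d q)) \<circ> frechet_derivative ?t (at (cmap c q))) (at (cmap c q))"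
    using has_derivative_transform_within_open[OF _ open_overlap[OF c(1) d(1)]] c(2) d(2) by blast
  show "frechet_derivative (f \<circ> cinv c) (at (cmap c q)) v =
      frechet_derivative (f \<circ> cinv d) (at (cmap d q)) (frechet_derivative ?t (at (cmap c q)) v)"
    using frechet_derivative_at[OF h] by (metis comp_apply)
qed

lemma linear_tchart: "c \<in> A \<Longrightarrow> q \<in> cdom c \<Longrightarrow> linear (tchart A c q)"
  unfolding tchart_def
  by (intro linear_frechet_derivative differentiable_transition chart_at)

lemma tchart_change_chart:
  assumes "c \<in> A" "q \<in> cdom c" "d \<in> A" "q \<in> cdom d"
  shows "tchart A d q v = frechet_derivative (cmap d \<circ> cinv c) (at (cmap c q)) (tchart A c q v)"
  unfolding tchart_def
  by (intro frechet_derivative_change_chart chart_at assms differentiable_transition)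

lemma frechet_derivative_same_chart:
  assumes "c \<in> A" "q \<in> cdom c"
  shows "frechet_derivative (cmap c \<circ> cinv c) (at (cmap c q)) v = v"
proof -
  have "id differentiable (at (cmap c q))"
    using has_derivative_id differentiable_def by blast
  then have "frechet_derivative id (at (cmap c q)) = frechet_derivative (cmap c \<circ> cinv c) (at (cmap c q))"
    using assms open_overlap[of c c]
    by (intro frechet_derivative_transform_within_open[where X = "cmap c ` cdom c"]) (auto simp: cinv_cmap)
  then show ?thesis by simp
qed

lemma tchart_chart_at [simp]: "tchart A (chart_at A p) p v = v"
  unfolding tchart_def by (intro frechet_derivative_same_chart chart_at)

text \<open>The definition uses the chart chosen at \<open>q\<close>, which may jump as
  \<open>q\<close> moves. In a fixed chart the dependence on \<open>q\<close> becomes smooth and can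
  be differentiated.\<close>

lemma dir_deriv_chart:
  assumes "c \<in> A" "q \<in> cdom c" "(f \<circ> cinv c) differentiable (at (cmap c q))"
  shows "dir_deriv A f q v = frechet_derivative (f \<circ> cinv c) (at (cmap c q)) (tchart A c q v)"
  unfolding dir_deriv_def tchart_def
  by (intro frechet_derivative_change_chart chart_at assms)

section \<open>Smooth functions and smooth vector fields\<close>

lemma smooth_fun_imp_smooth_on: "smooth_fun A U f \<Longrightarrow> c \<in> A \<Longrightarrow> smooth_on (cmap c ` (U \<inter> cdom c)) (f \<circ> cinv c)"
  by (simp add: smooth_fun_def)

lemma smooth_vf_imp_smooth_on: "smooth_vf A U X \<Longrightarrow> c \<in> A \<Longrightarrow> smooth_on (cmap c ` (U \<inter> cdom c)) (vf_rep A c X)"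
  by (simp add: smooth_vf_def)

lemma smooth_fun_imp_differentiable:
  "smooth_fun A U f \<Longrightarrow> c \<in> A \<Longrightarrow> q \<in> U \<Longrightarrow> q \<in> cdom c \<Longrightarrow> (f \<circ> cinv c) differentiable (at (cmap c q))"
  using smooth_on_imp_differentiable[OF smooth_fun_imp_smooth_on] by blast

lemma smooth_fun_subset: "smooth_fun A U f \<Longrightarrow> V \<subseteq> U \<Longrightarrow> smooth_fun A V f"
  unfolding smooth_fun_def by (meson Int_mono image_mono order_refl smooth_on_subset)

lemma smooth_vf_subset: "smooth_vf A U f \<Longrightarrow> V \<subseteq> U \<Longrightarrow> smooth_vf A V f"
  unfolding smooth_vf_def by (meson Int_mono image_mono order_refl smooth_on_subset)

text \<open>It suffices to give a smooth local expression \<open>h\<close> with the right values at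
  the points \<open>cmap c q\<close>; this removes \<open>cinv\<close> from later proofs.
  \<open>smooth_vfI\<close> does the same for fields.\<close>

lemma smooth_funI:
  assumes "open U"
    and "\<And>c. c \<in> A \<Longrightarrow> \<exists>h. smooth_on (cmap c ` (U \<inter> cdom c)) h \<and> (\<forall>q\<in>U \<inter> cdom c. h (cmap c q) = f q)"
  shows "smooth_fun A U f"
  unfolding smooth_fun_def
proof
  fix c assume c: "c \<in> A"
  then obtain h where h: "smooth_on (cmap c ` (U \<inter> cdom c)) h" "\<forall>q\<in>U \<inter> cdom c. h (cmap c q) = f q"
    using assms(2) by blast
  show "smooth_on (cmap c ` (U \<inter> cdom c)) (f \<circ> cinv c)"
    by (subst smooth_on_cong[OF open_image[OF c \<open>open U\<close>], of _ h]) (use h c in \<open>auto simp: cinv_cmap\<close>)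
qed

lemma smooth_vfI:
  assumes "open U"
    and "\<And>c. c \<in> A \<Longrightarrow> \<exists>h. smooth_on (cmap c ` (U \<inter> cdom c)) h \<and> (\<forall>q\<in>U \<inter> cdom c. h (cmap c q) = tchart A c q (X q))"
  shows "smooth_vf A U X"
  unfolding smooth_vf_def
proof
  fix c assume c: "c \<in> A"
  then obtain h where h: "smooth_on (cmap c ` (U \<inter> cdom c)) h"
      "\<forall>q\<in>U \<inter> cdom c. h (cmap c q) = tchart A c q (X q)"
    using assms(2) by blast
  show "smooth_on (cmap c ` (U \<inter> cdom c)) (vf_rep A c X)"
    by (subst smooth_on_cong[OF open_image[OF c \<open>open U\<close>], of _ h]) (use h c in \<open>auto simp: cinv_cmap vf_rep_def\<close>)
qed

lemma vf_rep_cmap: "c \<in> A \<Longrightarrow> q \<in> cdom c \<Longrightarrow> vf_rep A c X (cmap c q) = tchart A c q (X q)"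
  by (simp add: vf_rep_def cinv_cmap)

lemma smooth_fun_const: "open U \<Longrightarrow> smooth_fun A U (\<lambda>q. a)"
  using smooth_on_const by (intro smooth_funI) auto

lemma smooth_fun_bilinear:
  assumes "bounded_bilinear b" "open U" "smooth_fun A U f" "smooth_fun A U k"
  shows "smooth_fun A U (\<lambda>q. b (f q) (k q))"
proof (rule smooth_funI[OF \<open>open U\<close>])
  fix c assume c: "c \<in> A"
  show "\<exists>h. smooth_on (cmap c ` (U \<inter> cdom c)) h \<and> (\<forall>q\<in>U \<inter> cdom c. h (cmap c q) = b (f q) (k q))"
    using smooth_on_bilinear[OF assms(1) open_image[OF c assms(2)] assms(3,4)[THEN smooth_fun_imp_smooth_on, OF c]] c
    by (intro exI[of _ "\<lambda>x. b ((f \<circ> cinv c) x) ((k \<circ> cinv c) x)"]) (auto simp: cinv_cmap)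
qed

lemmas smooth_fun_mult = smooth_fun_bilinear[OF bounded_bilinear_mult]

lemma smooth_fun_inverse:
  assumes "open U" "smooth_fun A U f" "\<And>q. q \<in> U \<Longrightarrow> f q \<noteq> 0"
  shows "smooth_fun A U (\<lambda>q. inverse (f q))"
proof (rule smooth_funI[OF \<open>open U\<close>])
  fix c assume c: "c \<in> A"
  have "smooth_on (cmap c ` (U \<inter> cdom c)) (\<lambda>x. inverse ((f \<circ> cinv c) x))"
    using c assms by (intro smooth_on_inverse open_image smooth_fun_imp_smooth_on) (auto simp: cinv_cmap)
  then show "\<exists>h. smooth_on (cmap c ` (U \<inter> cdom c)) h \<and> (\<forall>q\<in>U \<inter> cdom c. h (cmap c q) = inverse (f q))"
    using c by (intro exI[of _ "\<lambda>x. inverse ((f \<circ> cinv c) x)"]) (auto simp: cinv_cmap)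
qed

lemma smooth_vf_scaleR:
  assumes "open U" "smooth_fun A U f" "smooth_vf A U X"
  shows "smooth_vf A U (\<lambda>q. f q *\<^sub>R X q)"
proof (rule smooth_vfI[OF \<open>open U\<close>])
  fix c assume c: "c \<in> A"
  show "\<exists>h. smooth_on (cmap c ` (U \<inter> cdom c)) h \<and> (\<forall>q\<in>U \<inter> cdom c. h (cmap c q) = tchart A c q (f q *\<^sub>R X q))"
    using smooth_on_bilinear[OF bounded_bilinear_scaleR open_image[OF c assms(1)]
        smooth_fun_imp_smooth_on[OF assms(2) c] smooth_vf_imp_smooth_on[OF assms(3) c]] c
    by (intro exI[of _ "\<lambda>x. (f \<circ> cinv c) x *\<^sub>R vf_rep A c X x"])
      (auto simp: cinv_cmap vf_rep_cmap linear_scale[OF linear_tchart])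
qed

lemma smooth_vf_add:
  assumes "open U" "smooth_vf A U X" "smooth_vf A U Y"
  shows "smooth_vf A U (\<lambda>q. X q + Y q)"
proof (rule smooth_vfI[OF \<open>open U\<close>])
  fix c assume c: "c \<in> A"
  show "\<exists>h. smooth_on (cmap c ` (U \<inter> cdom c)) h \<and> (\<forall>q\<in>U \<inter> cdom c. h (cmap c q) = tchart A c q (X q + Y q))"
    using smooth_on_add[OF open_image[OF c assms(1)] assms(2,3)[THEN smooth_vf_imp_smooth_on, OF c]] c
    by (intro exI[of _ "\<lambda>x. vf_rep A c X x + vf_rep A c Y x"])
      (auto simp: vf_rep_cmap linear_add[OF linear_tchart])
qed

lemma smooth_vf_uminus: "open U \<Longrightarrow> smooth_vf A U X \<Longrightarrow> smooth_vf A U (\<lambda>q. - X q)"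
  using smooth_vf_scaleR[OF _ smooth_fun_const[of U "-1"], of X] by simp

lemma smooth_vf_diff: "open U \<Longrightarrow> smooth_vf A U X \<Longrightarrow> smooth_vf A U Y \<Longrightarrow> smooth_vf A U (\<lambda>q. X q - Y q)"
  using smooth_vf_add[OF _ _ smooth_vf_uminus, of U X Y] by simp

lemma smooth_vf_cong:
  assumes "open U" "smooth_vf A U X" "\<And>q. q \<in> U \<Longrightarrow> X q = Y q"
  shows "smooth_vf A U Y"
proof (rule smooth_vfI[OF assms(1)])
  fix c assume "c \<in> A"
  then show "\<exists>h. smooth_on (cmap c ` (U \<inter> cdom c)) h \<and> (\<forall>q\<in>U \<inter> cdom c. h (cmap c q) = tchart A c q (Y q))"
    using assms by (intro exI[of _ "vf_rep A c X"]) (auto simp: smooth_vf_imp_smooth_on vf_rep_cmap)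
qed

lemma smooth_fun_dir_deriv:
  assumes "open U" "smooth_fun A U f" "smooth_vf A U X"
  shows "smooth_fun A U (\<lambda>q. dir_deriv A f q (X q))"
proof (rule smooth_funI[OF assms(1)])
  fix c assume c: "c \<in> A"
  have "smooth_on (cmap c ` (U \<inter> cdom c)) (\<lambda>x. frechet_derivative (f \<circ> cinv c) (at x) (vf_rep A c X x))"
    using assms c by (intro smooth_on_frechet_derivative_apply open_image smooth_fun_imp_smooth_on smooth_vf_imp_smooth_on)
  then show "\<exists>h. smooth_on (cmap c ` (U \<inter> cdom c)) h \<and> (\<forall>q\<in>U \<inter> cdom c. h (cmap c q) = dir_deriv A f q (X q))"
    using assms c
    by (intro exI[of _ "\<lambda>x. frechet_derivative (f \<circ> cinv c) (at x) (vf_rep A c X x)"])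
      (auto simp: vf_rep_cmap dir_deriv_chart smooth_fun_imp_differentiable)
qed

section \<open>Directional derivatives, coordinate functions and extension of tangent
  vectors\<close>

lemma linear_dir_deriv:
  assumes "smooth_fun A U f" "p \<in> U" shows "linear (dir_deriv A f p)"
  unfolding dir_deriv_def[abs_def]
  by (intro linear_frechet_derivative smooth_fun_imp_differentiable[OF assms(1)] chart_at assms(2))

lemma dir_deriv_cong:
  assumes "open U" "smooth_fun A U f" "p \<in> U" "\<And>q. q \<in> U \<Longrightarrow> f q = k q"
  shows "dir_deriv A f p v = dir_deriv A k p v"
proof -
  let ?c = "chart_at A p"
  have "frechet_derivative (f \<circ> cinv ?c) (at (cmap ?c p)) = frechet_derivative (k \<circ> cinv ?c) (at (cmap ?c p))"
  proof (rule frechet_derivative_transform_within_open)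
    show "(f \<circ> cinv ?c) differentiable (at (cmap ?c p))"
      by (intro smooth_fun_imp_differentiable[OF assms(2)] chart_at assms(3))
    show "open (cmap ?c ` (U \<inter> cdom ?c))" by (intro open_image chart_at assms(1))
    show "cmap ?c p \<in> cmap ?c ` (U \<inter> cdom ?c)" using assms(3) chart_at by blast
    show "(f \<circ> cinv ?c) x = (k \<circ> cinv ?c) x" if "x \<in> cmap ?c ` (U \<inter> cdom ?c)" for x
      using that assms(4) by (auto simp: cinv_cmap chart_at)
  qed
  then show ?thesis by (simp add: dir_deriv_def)
qed

lemma dir_deriv_const [simp]: "dir_deriv A (\<lambda>q. a) p v = 0"
  by (simp add: dir_deriv_def comp_def)

lemma dir_deriv_add:
  assumes "smooth_fun A U f" "smooth_fun A U k" "p \<in> U"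
  shows "dir_deriv A (\<lambda>q. f q + k q) p v = dir_deriv A f p v + dir_deriv A k p v"
proof -
  let ?c = "chart_at A p" and ?x = "cmap (chart_at A p) p"
  have "((\<lambda>x. (f \<circ> cinv ?c) x + (k \<circ> cinv ?c) x) has_derivative
      (\<lambda>v. frechet_derivative (f \<circ> cinv ?c) (at ?x) v + frechet_derivative (k \<circ> cinv ?c) (at ?x) v)) (at ?x)"
    by (rule has_derivative_add; simp only: frechet_derivative_works[symmetric])
      (intro smooth_fun_imp_differentiable[OF assms(1)] smooth_fun_imp_differentiable[OF assms(2)] chart_at assms(3))+
  from fun_cong[OF frechet_derivative_at[OF this], of v] show ?thesis
    unfolding dir_deriv_def comp_def by (rule sym)
qed

definition coord :: "'m \<Rightarrow> 'e \<Rightarrow> 'm \<Rightarrow> real" where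
  "coord p u q = cmap (chart_at A p) q \<bullet> u"

lemma smooth_fun_coord: "U \<subseteq> cdom (chart_at A p) \<Longrightarrow> open U \<Longrightarrow> smooth_fun A U (coord p u)"
proof (rule smooth_fun_subset[of "cdom (chart_at A p)"])
  let ?d = "chart_at A p"
  show "smooth_fun A (cdom ?d) (coord p u)"
    unfolding smooth_fun_def
  proof
    fix c assume c: "c \<in> A"
    have "smooth_on (cmap c ` (cdom c \<inter> cdom ?d)) (\<lambda>x. (cmap ?d \<circ> cinv c) x \<bullet> u)"
      using c chart_at by (intro smooth_on_bounded_linear_comp[OF bounded_linear_inner_left] open_overlap smooth_transition)
    then show "smooth_on (cmap c ` (cdom ?d \<inter> cdom c)) (coord p u \<circ> cinv c)"
      by (simp add: coord_def[abs_def] comp_def Int_commute)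
  qed
qed

lemma dir_deriv_coord: "dir_deriv A (coord p u) p v = v \<bullet> u"
proof -
  let ?d = "chart_at A p" and ?x = "cmap (chart_at A p) p"
  have "frechet_derivative (\<lambda>x. x \<bullet> u) (at ?x) = frechet_derivative (coord p u \<circ> cinv ?d) (at ?x)"
    using chart_at open_overlap[of ?d ?d]
    by (intro frechet_derivative_transform_within_open[where X = "cmap ?d ` cdom ?d"])
      (auto simp: cinv_cmap coord_def bounded_linear_imp_differentiable bounded_linear_inner_left)
  moreover have "frechet_derivative (\<lambda>x. x \<bullet> u) (at ?x) = (\<lambda>x. x \<bullet> u)"
    by (rule frechet_derivative_at[symmetric]) (rule bounded_linear_imp_has_derivative[OF bounded_linear_inner_left])
  ultimately show ?thesis unfolding dir_deriv_def by metis
qed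

text \<open>Coordinate functions already separate tangent vectors. They are smooth only on a chart
  domain, hence the test functions on smaller neighbourhoods \<open>V\<close>.\<close>

lemma dir_deriv_eqI:
  assumes "\<And>f V. open V \<Longrightarrow> p \<in> V \<Longrightarrow> V \<subseteq> U \<Longrightarrow> smooth_fun A V f \<Longrightarrow> dir_deriv A f p v = dir_deriv A f p w"
    and "open U" "p \<in> U"
  shows "v = w"
proof (rule euclidean_eqI)
  fix b
  show "v \<bullet> b = w \<bullet> b"
    using assms(1)[of "U \<inter> cdom (chart_at A p)" "coord p b"] assms(2,3) chart_at[of p]
    by (simp add: smooth_fun_coord open_Int open_cdom dir_deriv_coord)
qed

text \<open>The field with constant components \<open>v\<close> in the chart chosen at
  \<open>p\<close>. The derivative of the transition map converts \<open>v\<close> to the chart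
  chosen at \<open>q\<close>, in which a tangent vector at \<open>q\<close> is stored.\<close>

definition const_vf :: "'m \<Rightarrow> 'e \<Rightarrow> 'm \<Rightarrow> 'e" where
  "const_vf p v q = frechet_derivative (cmap (chart_at A q) \<circ> cinv (chart_at A p)) (at (cmap (chart_at A p) q)) v"

lemma const_vf_self: "const_vf p v p = v"
  unfolding const_vf_def by (intro frechet_derivative_same_chart chart_at)

lemma smooth_const_vf: "smooth_vf A (cdom (chart_at A p)) (const_vf p v)"
proof (rule smooth_vfI[OF open_cdom[OF chart_at(1)]])
  let ?d = "chart_at A p"
  fix c assume c: "c \<in> A"
  let ?S = "cmap c ` (cdom c \<inter> cdom ?d)" and ?T = "cmap ?d ` (cdom ?d \<inter> cdom c)"
  let ?h = "\<lambda>x. frechet_derivative (cmap c \<circ> cinv ?d) (at ((cmap ?d \<circ> cinv c) x)) v"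
  have "smooth_on ?S ?h"
  proof (rule smooth_on_compose[where T = ?T and g = "cmap ?d \<circ> cinv c"
        and f = "\<lambda>x. frechet_derivative (cmap c \<circ> cinv ?d) (at x) v"])
    show "open ?S" "open ?T" using c chart_at open_overlap by blast+
    show "smooth_on ?T (\<lambda>x. frechet_derivative (cmap c \<circ> cinv ?d) (at x) v)"
      using c chart_at by (intro smooth_on_frechet_derivative smooth_transition)
    show "smooth_on ?S (cmap ?d \<circ> cinv c)" using c chart_at by (intro smooth_transition)
    show "(cmap ?d \<circ> cinv c) ` ?S \<subseteq> ?T" using c by (auto simp: cinv_cmap)
  qed
  moreover have "?h (cmap c q) = tchart A c q (const_vf p v q)" if "q \<in> cdom ?d \<inter> cdom c" for q
    unfolding tchart_def const_vf_def using that c chart_at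
    by (simp add: cinv_cmap) (intro frechet_derivative_change_chart differentiable_transition; simp add: chart_at)
  ultimately show "\<exists>h. smooth_on (cmap c ` (cdom ?d \<inter> cdom c)) h \<and>
      (\<forall>q\<in>cdom ?d \<inter> cdom c. h (cmap c q) = tchart A c q (const_vf p v q))"
    by (intro exI[of _ ?h]) (simp add: Int_commute)
qed

lemma smooth_fun_nonzero_nbhd:
  assumes "open U" "smooth_fun A U f" "p \<in> U" "f p \<noteq> 0"
  obtains V where "open V" "p \<in> V" "V \<subseteq> U" "\<And>q. q \<in> V \<Longrightarrow> f q \<noteq> 0"
proof -
  let ?c = "chart_at A p"
  let ?W = "cmap ?c ` (U \<inter> cdom ?c)"
  have W: "open ?W" by (intro open_image chart_at assms(1))
  have "continuous_on ?W (f \<circ> cinv ?c)"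
    by (intro smooth_on_imp_continuous_on smooth_fun_imp_smooth_on assms chart_at)
  then have "open ((f \<circ> cinv ?c) -` (- {0}) \<inter> ?W)"
    using continuous_on_open_vimage[OF W, of "f \<circ> cinv ?c"] by (metis Int_commute open_Compl closed_singleton)
  moreover have "continuous_on (U \<inter> cdom ?c) (cmap ?c)" "open (U \<inter> cdom ?c)"
    using is_chart[OF chart_at(1), of p] assms(1)
    by (auto simp: is_chart_def homeomorphism_def intro: continuous_on_subset)
  ultimately have "open (cmap ?c -` ((f \<circ> cinv ?c) -` (- {0}) \<inter> ?W) \<inter> (U \<inter> cdom ?c))"
    using continuous_on_open_vimage by blast
  then show thesis
  proof (rule that)
    show "f q \<noteq> 0" if "q \<in> cmap ?c -` ((f \<circ> cinv ?c) -` (- {0}) \<inter> ?W) \<inter> (U \<inter> cdom ?c)" for q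
      using that cinv_cmap[OF chart_at(1), of q p] by auto
  qed (use assms chart_at in \<open>auto simp: cinv_cmap\<close>)
qed

text \<open>The bracket, defined by a coordinate formula, is the commutator of derivations: the
  second derivatives of \<open>f\<close> cancel by symmetry. Metric compatibility and the Jacobi
  identity are exploited through this fact.\<close>

lemma dir_deriv_commutator:
  assumes U: "open U" and X: "smooth_vf A U X" and Y: "smooth_vf A U Y" and f: "smooth_fun A U f" and p: "p \<in> U"
  shows "dir_deriv A (\<lambda>q. dir_deriv A f q (Y q)) p (X p) - dir_deriv A (\<lambda>q. dir_deriv A f q (X q)) p (Y p) =
    dir_deriv A f p (lie_bracket A X Y p)"
proof -
  let ?c = "chart_at A p"
  define x where "x = cmap ?c p"
  define S where "S = cmap ?c ` (U \<inter> cdom ?c)"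
  define k where "k = f \<circ> cinv ?c"
  define D where "D b y = frechet_derivative k (at y) b" for b y
  have S: "open S" unfolding S_def by (intro open_image chart_at U)
  have x: "x \<in> S" unfolding S_def x_def using p chart_at by blast
  have k: "smooth_on S k" unfolding S_def k_def by (intro smooth_fun_imp_smooth_on f chart_at)
  have D: "smooth_on S (D b)" for b
    unfolding D_def[abs_def] by (rule smooth_on_frechet_derivative[OF k])
  have lin: "linear (\<lambda>b. D b y)" if "y \<in> S" for y
    unfolding D_def using linear_frechet_derivative[OF smooth_on_imp_differentiable[OF k that]] by simp
  have Dsum: "D v y = (\<Sum>b\<in>Basis. (v \<bullet> b) * D b y)" if "y \<in> S" for v y
    unfolding D_def using frechet_derivative_Basis_sum[OF smooth_on_imp_differentiable[OF k that], of v]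
    unfolding real_scaleR_def .
  have DD: "frechet_derivative (D a) (at x) b = frechet_derivative (D b) (at x) a" for a b
    unfolding D_def[abs_def] by (rule frechet_derivative_symmetric[OF S k x])
  \<comment> \<open>Product rule for \<open>Z f\<close>: a first-order term carrying the derivative
    of \<open>Z\<close>, and the Hessian of \<open>f\<close> on \<open>u\<close> and
    \<open>Z p\<close>, which is symmetric and drops out of the commutator.\<close>
  have main: "dir_deriv A (\<lambda>q. dir_deriv A f q (Z q)) p u =
      D (frechet_derivative (vf_rep A ?c Z) (at x) u) x + frechet_derivative (D u) (at x) (Z p)"
    if Z: "smooth_vf A U Z" for Z u
  proof -
    let ?Z = "vf_rep A ?c Z"
    have Zs: "smooth_on S ?Z" unfolding S_def by (intro smooth_vf_imp_smooth_on Z chart_at)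
    have Zx: "?Z x = Z p" unfolding x_def using chart_at by (simp add: vf_rep_cmap)
    have "((\<lambda>y. \<Sum>b\<in>Basis. (?Z y \<bullet> b) * D b y) has_derivative
        (\<lambda>u. \<Sum>b\<in>Basis. (?Z x \<bullet> b) * frechet_derivative (D b) (at x) u + (frechet_derivative ?Z (at x) u \<bullet> b) * D b x)) (at x)"
      by (intro has_derivative_sum has_derivative_mult has_derivative_inner_left
          smooth_on_imp_has_derivative[OF Zs x] smooth_on_imp_has_derivative[OF D x])
    moreover have "(\<Sum>b\<in>Basis. (?Z y \<bullet> b) * D b y) = ((\<lambda>q. dir_deriv A f q (Z q)) \<circ> cinv ?c) y" if y: "y \<in> S" for y
    proof -
      obtain q where q: "y = cmap ?c q" "q \<in> U" "q \<in> cdom ?c" using y S_def by blast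
      have "((\<lambda>q. dir_deriv A f q (Z q)) \<circ> cinv ?c) y = D (?Z y) y"
        using q by (simp add: cinv_cmap chart_at dir_deriv_chart[OF chart_at(1)[of p]] smooth_fun_imp_differentiable[OF f] vf_rep_cmap D_def k_def)
      then show ?thesis by (simp only: Dsum[OF y, of "?Z y"])
    qed
    ultimately have "((\<lambda>q. dir_deriv A f q (Z q)) \<circ> cinv ?c has_derivative
        (\<lambda>u. \<Sum>b\<in>Basis. (?Z x \<bullet> b) * frechet_derivative (D b) (at x) u + (frechet_derivative ?Z (at x) u \<bullet> b) * D b x)) (at x)"
      using has_derivative_transform_within_open[OF _ S x] by blast
    from fun_cong[OF frechet_derivative_at[OF this], of u]
    have "dir_deriv A (\<lambda>q. dir_deriv A f q (Z q)) p u =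
      (\<Sum>b\<in>Basis. (Z p \<bullet> b) * frechet_derivative (D b) (at x) u + (frechet_derivative ?Z (at x) u \<bullet> b) * D b x)"
      unfolding dir_deriv_def[of A "\<lambda>q. dir_deriv A f q (Z q)"] x_def[symmetric] Zx by (rule sym)
    \<comment> \<open>Swapping \<open>b\<close> and \<open>u\<close> by symmetry turns the sum over
      \<open>b\<close> into the basis expansion of one linear map at \<open>Z p\<close>.\<close>
    also have "\<dots> = (\<Sum>b\<in>Basis. (Z p \<bullet> b) * frechet_derivative (D u) (at x) b) + D (frechet_derivative ?Z (at x) u) x"
      by (simp only: sum.distrib DD[of _ u] Dsum[OF x, of "frechet_derivative ?Z (at x) u"])
    also have "(\<Sum>b\<in>Basis. (Z p \<bullet> b) * frechet_derivative (D u) (at x) b) = frechet_derivative (D u) (at x) (Z p)"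
      using frechet_derivative_Basis_sum[OF smooth_on_imp_differentiable[OF D x], of u "Z p"]
      unfolding real_scaleR_def by (rule sym)
    finally show ?thesis by simp
  qed
  have "dir_deriv A f p w = D w x" for w
    unfolding dir_deriv_def D_def k_def x_def ..
  moreover have "D (v - w) x = D v x - D w x" for v w
    using linear_diff[OF lin[OF x]] .
  ultimately show ?thesis
    using main[OF X, of "Y p"] main[OF Y, of "X p"] DD[of "X p" "Y p"]
    by (simp add: lie_bracket_def Let_def x_def[symmetric])
qed

end

section \<open>Algebraic curvature tensors\<close>

text \<open>The arguments are local vector fields, which form a subgroup \<open>S\<close> of all functions; only additivity
  is needed, so the curvature need not be shown to be a tensor.\<close>

locale algebraic_curvature =
  fixes S :: "'v::ab_group_add set" and R :: "'v \<Rightarrow> 'v \<Rightarrow> 'v \<Rightarrow> 'v \<Rightarrow> real"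
  assumes add_closed [simp]: "x \<in> S \<Longrightarrow> y \<in> S \<Longrightarrow> x + y \<in> S"
    and uminus_closed [simp]: "x \<in> S \<Longrightarrow> - x \<in> S"
    and add1: "x \<in> S \<Longrightarrow> x' \<in> S \<Longrightarrow> y \<in> S \<Longrightarrow> z \<in> S \<Longrightarrow> w \<in> S \<Longrightarrow> R (x + x') y z w = R x y z w + R x' y z w"
    and skew12: "x \<in> S \<Longrightarrow> y \<in> S \<Longrightarrow> z \<in> S \<Longrightarrow> w \<in> S \<Longrightarrow> R y x z w = - R x y z w"
    and skew34: "x \<in> S \<Longrightarrow> y \<in> S \<Longrightarrow> z \<in> S \<Longrightarrow> w \<in> S \<Longrightarrow> R x y w z = - R x y z w"
    and bianchi: "x \<in> S \<Longrightarrow> y \<in> S \<Longrightarrow> z \<in> S \<Longrightarrow> w \<in> S \<Longrightarrow> R x y z w + R y z x w + R z x y w = 0"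
begin

text \<open>Four Bianchi identities, one for each cyclic rotation of \<open>x\<close>,
  \<open>y\<close>, \<open>z\<close>, \<open>w\<close>, combine with the two skew
  symmetries.\<close>

lemma pair_sym:
  assumes "x \<in> S" "y \<in> S" "z \<in> S" "w \<in> S"
  shows "R z w x y = R x y z w"
  using bianchi[OF assms(1,2,3,4)] bianchi[OF assms(2,3,4,1)] bianchi[OF assms(3,4,1,2)] bianchi[OF assms(4,1,2,3)]
    skew34[OF assms(2,3,4,1)] skew12[OF assms(1,3,2,4)] skew34[OF assms(1,3,4,2)] skew34[OF assms(3,4,1,2)]
    skew12[OF assms(2,4,3,1)] skew34[OF assms(2,4,1,3)] skew34[OF assms(4,1,2,3)] skew34[OF assms(1,2,3,4)]
  by linarith

lemma add2: "x \<in> S \<Longrightarrow> y \<in> S \<Longrightarrow> y' \<in> S \<Longrightarrow> z \<in> S \<Longrightarrow> w \<in> S \<Longrightarrow> R x (y + y') z w = R x y z w + R x y' z w"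
  using add1[of y y' x z w] by (simp add: skew12[of _ x])

lemma add3: "x \<in> S \<Longrightarrow> y \<in> S \<Longrightarrow> z \<in> S \<Longrightarrow> z' \<in> S \<Longrightarrow> w \<in> S \<Longrightarrow> R x y (z + z') w = R x y z w + R x y z' w"
  using add1[of z z' w x y] by (simp add: pair_sym[of x y])

lemma add4: "x \<in> S \<Longrightarrow> y \<in> S \<Longrightarrow> z \<in> S \<Longrightarrow> w \<in> S \<Longrightarrow> w' \<in> S \<Longrightarrow> R x y z (w + w') = R x y z w + R x y z w'"
  using add3[of x y w w' z] by (simp add: skew34[of x y z])

text \<open>Only additivity is at hand: doubling shows that the value at 0 is 0, and 0 lies in
  \<open>S\<close> as \<open>x + - x\<close>.\<close>

lemma uminus1: "x \<in> S \<Longrightarrow> y \<in> S \<Longrightarrow> z \<in> S \<Longrightarrow> w \<in> S \<Longrightarrow> R (- x) y z w = - R x y z w"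
  using add1[of x "- x" y z w] add1[of 0 0 y z w] add_closed[of x "- x"] by simp

lemma uminus2: "x \<in> S \<Longrightarrow> y \<in> S \<Longrightarrow> z \<in> S \<Longrightarrow> w \<in> S \<Longrightarrow> R x (- y) z w = - R x y z w"
  using uminus1[of y x z w] by (simp add: skew12[of _ x])

lemma uminus3: "x \<in> S \<Longrightarrow> y \<in> S \<Longrightarrow> z \<in> S \<Longrightarrow> w \<in> S \<Longrightarrow> R x y (- z) w = - R x y z w"
  using uminus1[of z w x y] by (simp add: pair_sym[of x y])

lemma uminus4: "x \<in> S \<Longrightarrow> y \<in> S \<Longrightarrow> z \<in> S \<Longrightarrow> w \<in> S \<Longrightarrow> R x y z (- w) = - R x y z w"
  using uminus3[of x y w z] by (simp add: skew34[of x y z])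

lemmas additive = add1 add2 add3 add4 uminus1 uminus2 uminus3 uminus4

text \<open>Two polarizations make \<open>R\<close> skew in its first and third arguments as well.
  The three terms of the Bianchi identity are then equal, so each vanishes.\<close>

lemma eq_zero_if_sectional_zero:
  assumes zero: "\<And>x y. x \<in> S \<Longrightarrow> y \<in> S \<Longrightarrow> R x y x y = 0"
    and S: "x \<in> S" "y \<in> S" "z \<in> S" "w \<in> S"
  shows "R x y z w = 0"
proof -
  have 1: "R x y x w = 0" if "x \<in> S" "y \<in> S" "w \<in> S" for x y w
    using zero[of x "y + w"] zero[of x y] zero[of x w] pair_sym[of x y x w] that by (simp add: additive)
  have 2: "R x y u w = - R u y x w" if "x \<in> S" "y \<in> S" "u \<in> S" "w \<in> S" for x y u w
    using 1[of "x + u" y w] 1[of x y w] 1[of u y w] that by (simp add: additive)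
  show ?thesis
    using bianchi[OF S] 2[OF S] 2[OF S(2,3,1,4)] skew12[OF S(2,3,1,4)] skew12[OF S(1,3,2,4)] skew12[OF S]
      2[OF S(3,1,2,4)] by linarith
qed

end

text \<open>\<open>type\<close> is Gray's identity with the value from constant type inserted, so
  the covariant derivative of \<open>J\<close> no longer appears. \<open>holomorphic\<close> is the
  sectional curvature condition cleared of its denominator, which is \<open>(G x x)\<^sup>2\<close>
  for the plane of \<open>x\<close> and \<open>J x\<close>.\<close>

locale nearly_kaehler_curvature = algebraic_curvature S R
  for S :: "'v::ab_group_add set" and R +
  fixes J :: "'v \<Rightarrow> 'v" and G :: "'v \<Rightarrow> 'v \<Rightarrow> real" and c \<alpha> :: real
  assumes J_closed [simp]: "x \<in> S \<Longrightarrow> J x \<in> S"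
    and J_add: "x \<in> S \<Longrightarrow> y \<in> S \<Longrightarrow> J (x + y) = J x + J y"
    and JJ: "x \<in> S \<Longrightarrow> J (J x) = - x"
    and G_add: "x \<in> S \<Longrightarrow> y \<in> S \<Longrightarrow> z \<in> S \<Longrightarrow> G (x + y) z = G x z + G y z"
    and G_sym: "x \<in> S \<Longrightarrow> y \<in> S \<Longrightarrow> G x y = G y x"
    and G_J: "x \<in> S \<Longrightarrow> y \<in> S \<Longrightarrow> G (J x) (J y) = G x y"
    and type: "x \<in> S \<Longrightarrow> y \<in> S \<Longrightarrow> R x y (J x) (J y) - R x y x y =
      \<alpha> * (G x x * G y y - (G x y)\<^sup>2 - (G x (J y))\<^sup>2)"
    and holomorphic: "x \<in> S \<Longrightarrow> R x (J x) (J x) x = c * (G x x)\<^sup>2"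
begin

lemma J_uminus: "x \<in> S \<Longrightarrow> J (- x) = - J x"
  using JJ[of "J x"] JJ[of x] by simp

lemma G_add2: "x \<in> S \<Longrightarrow> y \<in> S \<Longrightarrow> z \<in> S \<Longrightarrow> G x (y + z) = G x y + G x z"
  using G_add[of y z x] by (simp add: G_sym[of x])

lemma G_uminus: "x \<in> S \<Longrightarrow> y \<in> S \<Longrightarrow> G (- x) y = - G x y"
  using G_add[of x "- x" y] G_add[of 0 0 y] add_closed[of x "- x"] by simp

lemma G_uminus2: "x \<in> S \<Longrightarrow> y \<in> S \<Longrightarrow> G x (- y) = - G x y"
  using G_uminus[of y x] by (simp add: G_sym[of x])

lemma G_J_left: "x \<in> S \<Longrightarrow> y \<in> S \<Longrightarrow> G (J x) y = - G x (J y)"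
  using G_J[of x "J y"] by (simp add: JJ G_uminus2)

text \<open>The difference of the two sides is again an algebraic curvature tensor, so its sectional
  values decide. These vanish because the right-hand side of \<open>type\<close> and, by pair
  symmetry, the term \<open>R x y (J x) (J y)\<close> do not change when \<open>x\<close>,
  \<open>y\<close> are replaced by \<open>J x\<close>, \<open>J y\<close>.\<close>

lemma J_invariant:
  assumes "x \<in> S" "y \<in> S" "z \<in> S" "w \<in> S"
  shows "R (J x) (J y) (J z) (J w) = R x y z w"
proof -
  interpret E: algebraic_curvature S "\<lambda>x y z w. R x y z w - R (J x) (J y) (J z) (J w)"
  proof
    fix x y z w assume S: "x \<in> S" "y \<in> S" "z \<in> S" "w \<in> S"
    show "R y x z w - R (J y) (J x) (J z) (J w) = - (R x y z w - R (J x) (J y) (J z) (J w))"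
      using skew12[of x y z w] skew12[of "J x" "J y" "J z" "J w"] S by simp
    show "R x y w z - R (J x) (J y) (J w) (J z) = - (R x y z w - R (J x) (J y) (J z) (J w))"
      using skew34[of x y z w] skew34[of "J x" "J y" "J z" "J w"] S by simp
    show "R x y z w - R (J x) (J y) (J z) (J w) + (R y z x w - R (J y) (J z) (J x) (J w)) +
       (R z x y w - R (J z) (J x) (J y) (J w)) = 0"
      using bianchi[of x y z w] bianchi[of "J x" "J y" "J z" "J w"] S by simp
  qed (simp_all add: J_add additive)
  have "R x y x y - R (J x) (J y) (J x) (J y) = 0" if "x \<in> S" "y \<in> S" for x y
    using type[of x y] type[of "J x" "J y"] pair_sym[of x y "J x" "J y"] that
    by (simp add: JJ additive G_J G_uminus2 G_J_left)
  from E.eq_zero_if_sectional_zero[OF this assms] show ?thesis by simp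
qed

lemma holomorphic_polarized:
  assumes S: "x \<in> S" "y \<in> S"
  shows "R x (J x) (J y) y + 2 * R x (J y) (J x) y + \<alpha> * (G x x * G y y - (G x y)\<^sup>2 - (G x (J y))\<^sup>2) =
    c * (G x x * G y y + 2 * (G x y)\<^sup>2)"
proof -
  \<comment> \<open>Adding \<open>holomorphic\<close> at \<open>x + y\<close> and
    \<open>x - y\<close> and removing the values at \<open>x\<close> and \<open>y\<close> leaves
    twice the terms quadratic in both vectors.\<close>
  have six: "R x (J x) (J y) y + R y (J y) (J x) x + R y (J x) (J y) x + R x (J y) (J x) y
      + R y (J x) (J x) y + R x (J y) (J y) x = c * (2 * G x x * G y y + 4 * (G x y)\<^sup>2)"
    using holomorphic[of "x + y"] holomorphic[of "x + - y"] holomorphic[of x] holomorphic[of y] S G_sym[of y x]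
    by (simp del: add_uminus_conv_diff
        add: J_add J_uminus additive G_add G_add2 G_uminus G_uminus2 power2_eq_square)
      (simp add: algebra_simps)
  have "R y (J x) (J y) x = R x (J y) (J x) y"
    using pair_sym[of y "J x" "J y" x] skew12[of "J y" x y "J x"] skew34[of x "J y" y "J x"] S by simp
  moreover have "R y (J y) (J x) x = R x (J x) (J y) y"
    using pair_sym[of y "J y" "J x" x] skew12[of "J x" x y "J y"] skew34[of x "J x" y "J y"] S by simp
  \<comment> \<open>This term and the next are sectional values; \<open>type\<close> for
    \<open>y\<close>, \<open>J x\<close> and for \<open>x\<close>, \<open>J y\<close> trades them
    for the second curvature term of the claim, each at the cost of one \<alpha>-correction.\<close>
  moreover have "R y (J x) (J x) y = R y (J x) (J y) x + \<alpha> * (G x x * G y y - (G x y)\<^sup>2 - (G x (J y))\<^sup>2)"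
    using type[of y "J x"] skew34[of y "J x" y "J x"] S G_sym[of y x] G_J_left[of x y] G_sym[of y "J x"]
    by (simp add: JJ additive G_J G_uminus2 algebra_simps)
  moreover have "R x (J y) (J y) x = R x (J y) (J x) y + \<alpha> * (G x x * G y y - (G x y)\<^sup>2 - (G x (J y))\<^sup>2)"
    using type[of x "J y"] skew34[of x "J y" x "J y"] S
    by (simp add: JJ additive G_J G_uminus2 algebra_simps)
  ultimately show ?thesis using six by (simp add: algebra_simps)
qed

text \<open>\<open>holomorphic_polarized\<close> for \<open>x\<close>, \<open>y\<close> and for
  \<open>x\<close>, \<open>J y\<close> gives two linear equations in three curvature values, the
  Bianchi identity a third. Their sum isolates \<open>4 * R x (J x) (J y) y\<close>.\<close>

lemma curvature_J_plane_quadratic: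
  assumes S: "x \<in> S" "y \<in> S"
  shows "2 * R x (J x) (J y) y = c * (G x x * G y y + (G x y)\<^sup>2 + (G x (J y))\<^sup>2)
    - \<alpha> * (G x x * G y y - (G x y)\<^sup>2 - (G x (J y))\<^sup>2)"
proof -
  have "R x (J x) y (J y) = - R x (J x) (J y) y" using skew34[of x "J x" "J y" y] S by simp
  then have "R x (J x) (J y) y - 2 * R x y (J x) (J y) + \<alpha> * (G x x * G y y - (G x y)\<^sup>2 - (G x (J y))\<^sup>2) =
      c * (G x x * G y y + 2 * (G x (J y))\<^sup>2)"
    using holomorphic_polarized[of x "J y"] S by (simp add: JJ additive G_J G_uminus2 algebra_simps)
  moreover have "R x (J x) (J y) y = R x (J y) (J x) y - R x y (J x) (J y)"
    using bianchi[of x "J x" "J y" y] pair_sym[of x y "J x" "J y"] skew12[of x "J y" "J x" y] S by simp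
  ultimately show ?thesis using holomorphic_polarized[OF S] by (simp add: algebra_simps)
qed

text \<open>By \<open>J_invariant\<close>, \<open>R x (J x) (J y) z\<close> is symmetric in
  \<open>y\<close> and \<open>z\<close>, so polarizing the quadratic formula recovers it; the
  orthogonality conditions kill the squared terms, also at \<open>y + z\<close>.\<close>

lemma curvature_J_plane:
  assumes S: "x \<in> S" "y \<in> S" "z \<in> S"
    and orth: "G x y = 0" "G x (J y) = 0" "G x z = 0" "G x (J z) = 0"
  shows "2 * R x (J x) (J y) z = (c - \<alpha>) * G x x * G y z"
proof -
  have "R x (J x) (J z) y = R x (J x) (J y) z"
    using J_invariant[of x "J x" "J z" y] skew12[of x "J x" z "J y"] skew34[of x "J x" "J y" z] S
    by (simp add: JJ additive)
  then show ?thesis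
    using curvature_J_plane_quadratic[of x "y + z"] curvature_J_plane_quadratic[of x y]
      curvature_J_plane_quadratic[of x z] S orth G_sym[of z y]
    by (simp add: J_add additive G_add G_add2 algebra_simps)
qed

end

section \<open>The Levi-Civita connection and its curvature\<close>

lemma lie_bracket_skew: "lie_bracket A X Y p = - lie_bracket A Y X p"
  by (simp add: lie_bracket_def Let_def)

text \<open>A fixed open \<open>U\<close> makes the fields smooth on it an additive group, the
  carrier on which the curvature algebra operates. Smaller regions are further
  interpretations.\<close>

locale levi_civita_region = smooth_manifold A
  for A :: "('m::{t2_space,second_countable_topology}, 'e::euclidean_space) chart set" +
  fixes g :: "'m \<Rightarrow> 'e \<Rightarrow> 'e \<Rightarrow> real" and nabla :: "('m, 'e) conn" and U :: "'m set"
  assumes metric: "riemannian_metric A g" and levi_civita: "levi_civita A g nabla" and open_U: "open U"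
begin

lemma bilinear_g: "bilinear (g p)" and g_sym: "g p u v = g p v u" and g_pos: "v \<noteq> 0 \<Longrightarrow> 0 < g p v v"
  using metric by (auto simp: riemannian_metric_def)

lemmas g_linear = bilinear_ladd[OF bilinear_g] bilinear_radd[OF bilinear_g]
  bilinear_lsub[OF bilinear_g] bilinear_rsub[OF bilinear_g] bilinear_lneg[OF bilinear_g] bilinear_rneg[OF bilinear_g]
  bilinear_lzero[OF bilinear_g] bilinear_rzero[OF bilinear_g] bilinear_lmul[OF bilinear_g] bilinear_rmul[OF bilinear_g]

lemma smooth_metric:
  assumes "smooth_vf A U X" "smooth_vf A U Y" shows "smooth_fun A U (\<lambda>q. g q (X q) (Y q))"
  using metric[unfolded riemannian_metric_def, THEN conjunct2, rule_format, of U X Y] open_U assms by simp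

lemma affine: "affine_connection A nabla"
  using levi_civita by (simp add: levi_civita_def)

lemma smooth_cov:
  assumes "smooth_vf A U X" "smooth_vf A U Y" shows "smooth_vf A U (cov nabla X Y)"
  using affine[unfolded affine_connection_def, THEN conjunct1, rule_format, of U X Y] open_U assms by simp

lemma linear_nabla:
  assumes "smooth_vf A U Y" "p \<in> U" shows "linear (\<lambda>v. nabla p v Y)"
  using affine[unfolded affine_connection_def, THEN conjunct2, THEN conjunct1, rule_format, of U Y p] open_U assms
  by simp

lemma nabla_add_left: "smooth_vf A U Y \<Longrightarrow> p \<in> U \<Longrightarrow> nabla p (v + w) Y = nabla p v Y + nabla p w Y"
  by (rule linear_add[OF linear_nabla])

lemma nabla_diff_left: "smooth_vf A U Y \<Longrightarrow> p \<in> U \<Longrightarrow> nabla p (v - w) Y = nabla p v Y - nabla p w Y"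
  by (rule linear_diff[OF linear_nabla])

lemma nabla_uminus_left: "smooth_vf A U Y \<Longrightarrow> p \<in> U \<Longrightarrow> nabla p (- v) Y = - nabla p v Y"
  by (rule linear_neg[OF linear_nabla])

lemma nabla_add:
  assumes "smooth_vf A U Y" "smooth_vf A U Z" "p \<in> U"
  shows "nabla p v (\<lambda>q. Y q + Z q) = nabla p v Y + nabla p v Z"
  using affine[unfolded affine_connection_def, THEN conjunct2, THEN conjunct2, THEN conjunct1, rule_format, of U Y Z p v]
    open_U assms by simp

lemma nabla_scaleR:
  assumes "smooth_fun A U f" "smooth_vf A U Y" "p \<in> U"
  shows "nabla p v (\<lambda>q. f q *\<^sub>R Y q) = dir_deriv A f p v *\<^sub>R Y p + f p *\<^sub>R nabla p v Y"
  using affine[unfolded affine_connection_def, THEN conjunct2, THEN conjunct2, THEN conjunct2, THEN conjunct1,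
      rule_format, of U f Y p v] open_U assms by simp

lemma nabla_cong:
  assumes "smooth_vf A U Y" "p \<in> U" "\<And>q. q \<in> U \<Longrightarrow> Z q = Y q"
  shows "nabla p v Z = nabla p v Y"
  using affine[unfolded affine_connection_def, THEN conjunct2, THEN conjunct2, THEN conjunct2, THEN conjunct2,
      rule_format, of U Y p Z v] open_U assms by simp

lemma nabla_uminus: "smooth_vf A U Y \<Longrightarrow> p \<in> U \<Longrightarrow> nabla p v (\<lambda>q. - Y q) = - nabla p v Y"
  using nabla_scaleR[OF smooth_fun_const[OF open_U, of "-1"]] by simp

lemma nabla_zero:
  assumes "p \<in> U" "\<And>q. q \<in> U \<Longrightarrow> Y q = 0" shows "nabla p v Y = 0"
proof -
  have z: "smooth_vf A U (\<lambda>q. 0)"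
    by (rule smooth_vfI[OF open_U])
      (auto intro!: exI[of _ "\<lambda>x. 0"] smooth_on_const simp: linear_0[OF linear_tchart])
  have "nabla p v Y = nabla p v (\<lambda>q. 0)" using z assms by (intro nabla_cong) auto
  then show ?thesis using nabla_scaleR[OF smooth_fun_const[OF open_U, of 0] z assms(1), of v] by simp
qed

lemma torsion_free:
  assumes "smooth_vf A U X" "smooth_vf A U Y" "p \<in> U"
  shows "lie_bracket A X Y p = nabla p (X p) Y - nabla p (Y p) X"
  using levi_civita[unfolded levi_civita_def, THEN conjunct2, THEN conjunct1, rule_format, of U X Y p] open_U assms
  by (simp add: cov_def)

lemma metric_compatible:
  assumes "smooth_vf A U X" "smooth_vf A U Y" "p \<in> U"
  shows "dir_deriv A (\<lambda>q. g q (X q) (Y q)) p v = g p (nabla p v X) (Y p) + g p (X p) (nabla p v Y)"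
  using levi_civita[unfolded levi_civita_def, THEN conjunct2, THEN conjunct2, rule_format, of U X Y p v] open_U assms
  by simp

text \<open>Torsion-freeness writes the bracket as a difference of covariant derivatives, whose
  smoothness is part of the definition of a connection.\<close>

lemma smooth_lie_bracket:
  assumes "smooth_vf A U X" "smooth_vf A U Y" shows "smooth_vf A U (lie_bracket A X Y)"
  by (rule smooth_vf_cong[OF open_U smooth_vf_diff[OF open_U smooth_cov[OF assms] smooth_cov[OF assms(2,1)]]])
    (simp add: torsion_free[OF assms] cov_def)

section \<open>Symmetries of the curvature\<close>

lemma curvature_skew12:
  assumes "smooth_vf A U X" "smooth_vf A U Y" "smooth_vf A U Z" "p \<in> U"
  shows "curvature A nabla Y X Z p = - curvature A nabla X Y Z p"
  using assms lie_bracket_skew[of A Y X p] by (simp add: curvature_def cov_def nabla_uminus_left)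

lemma curvature_add1:
  assumes X: "smooth_vf A U X" and X': "smooth_vf A U X'" and Y: "smooth_vf A U Y" and Z: "smooth_vf A U Z" and p: "p \<in> U"
  shows "curvature A nabla (X + X') Y Z p = curvature A nabla X Y Z p + curvature A nabla X' Y Z p"
proof -
  have XX: "smooth_vf A U (X + X')" using smooth_vf_add[OF open_U X X'] by (simp add: plus_fun_def)
  have "nabla p v (cov nabla (X + X') Z) = nabla p v (\<lambda>q. cov nabla X Z q + cov nabla X' Z q)" for v
    using X X' Z p by (intro nabla_cong smooth_vf_add[OF open_U] smooth_cov) (auto simp: cov_def nabla_add_left)
  then have 1: "nabla p v (cov nabla (X + X') Z) = nabla p v (cov nabla X Z) + nabla p v (cov nabla X' Z)" for v
    using X X' Z p by (simp add: nabla_add smooth_cov)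
  have 2: "nabla p v (X + X') = nabla p v X + nabla p v X'" for v
    using nabla_add[OF X X' p] by (simp add: plus_fun_def)
  have "lie_bracket A (X + X') Y p = lie_bracket A X Y p + lie_bracket A X' Y p"
    using X X' Y XX p by (simp add: torsion_free 2 nabla_add_left)
  then show ?thesis
    using X X' Y Z XX p smooth_cov[OF Y Z] by (simp add: curvature_def cov_def[of nabla _ _ p] 1 nabla_add_left)
qed

text \<open>Second derivatives of \<open>g(Z,W)\<close> along \<open>X\<close> and \<open>Y\<close>
  commute up to the bracket. In the commutator the products of two first covariant derivatives
  cancel, and the curvature terms remain.\<close>

lemma curvature_skew34:
  assumes X: "smooth_vf A U X" and Y: "smooth_vf A U Y" and Z: "smooth_vf A U Z" and W: "smooth_vf A U W" and p: "p \<in> U"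
  shows "g p (curvature A nabla X Y W p) (Z p) = - g p (curvature A nabla X Y Z p) (W p)"
proof -
  let ?a = "\<lambda>q. g q (Z q) (W q)"
  have second: "dir_deriv A (\<lambda>q. dir_deriv A ?a q (Y q)) p v =
      g p (nabla p v (cov nabla Y Z)) (W p) + g p (nabla p (Y p) Z) (nabla p v W)
      + (g p (nabla p v Z) (nabla p (Y p) W) + g p (Z p) (nabla p v (cov nabla Y W)))"
    if Y: "smooth_vf A U Y" for Y v
  proof -
    have s: "smooth_fun A U (\<lambda>q. g q (cov nabla Y Z q) (W q))" "smooth_fun A U (\<lambda>q. g q (Z q) (cov nabla Y W q))"
      by (intro smooth_metric smooth_cov Y Z W)+
    have "dir_deriv A (\<lambda>q. dir_deriv A ?a q (Y q)) p v =
        dir_deriv A (\<lambda>q. g q (cov nabla Y Z q) (W q) + g q (Z q) (cov nabla Y W q)) p v"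
      using p by (intro dir_deriv_cong[OF open_U] smooth_fun_dir_deriv smooth_metric Y Z W open_U)
        (simp_all add: metric_compatible Z W cov_def)
    also have "\<dots> = dir_deriv A (\<lambda>q. g q (cov nabla Y Z q) (W q)) p v + dir_deriv A (\<lambda>q. g q (Z q) (cov nabla Y W q)) p v"
      using s p by (intro dir_deriv_add)
    finally show ?thesis
      using metric_compatible[OF smooth_cov[OF Y Z] W p] metric_compatible[OF Z smooth_cov[OF Y W] p]
      by (simp add: cov_def)
  qed
  have "g p (nabla p (X p) (cov nabla Y Z)) (W p) + g p (Z p) (nabla p (X p) (cov nabla Y W))
      - g p (nabla p (Y p) (cov nabla X Z)) (W p) - g p (Z p) (nabla p (Y p) (cov nabla X W))
      = g p (nabla p (lie_bracket A X Y p) Z) (W p) + g p (Z p) (nabla p (lie_bracket A X Y p) W)"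
    using dir_deriv_commutator[OF open_U X Y smooth_metric[OF Z W] p] second[OF X] second[OF Y]
      metric_compatible[OF Z W p] by simp
  then show ?thesis
    by (simp add: curvature_def cov_def[of nabla _ _ p] g_linear g_sym[of p _ "Z p"])
qed

text \<open>Both sides are tested on functions, where brackets are commutators and all third-order
  terms cancel in the cyclic sum.\<close>

lemma jacobi:
  assumes X: "smooth_vf A U X" and Y: "smooth_vf A U Y" and Z: "smooth_vf A U Z" and p: "p \<in> U"
  shows "lie_bracket A X (lie_bracket A Y Z) p + lie_bracket A Y (lie_bracket A Z X) p
    + lie_bracket A Z (lie_bracket A X Y) p = 0"
proof (rule dir_deriv_eqI[OF _ open_U p])
  fix f V assume V: "open V" "p \<in> V" "V \<subseteq> U" and f: "smooth_fun A V f"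
  define D where "D X f = (\<lambda>q. dir_deriv A f q (X q))" for X :: "'m \<Rightarrow> 'e" and f
  note fields = X Y Z smooth_lie_bracket[OF X Y] smooth_lie_bracket[OF Y Z] smooth_lie_bracket[OF Z X]
  have sD: "smooth_fun A V (D X h)" if "smooth_vf A U X" "smooth_fun A V h" for X h
    unfolding D_def using that V smooth_vf_subset by (intro smooth_fun_dir_deriv) auto
  have comm: "D (lie_bracket A X Y) h q = D X (D Y h) q - D Y (D X h) q"
    if "smooth_vf A U X" "smooth_vf A U Y" "smooth_fun A V h" "q \<in> V" for X Y h q
    unfolding D_def
    using dir_deriv_commutator[OF V(1) smooth_vf_subset[OF that(1) V(3)] smooth_vf_subset[OF that(2) V(3)] that(3,4)]
    by simp
  \<comment> \<open>\<open>comm\<close> is an equality on \<open>V\<close> only; one more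
    differentiation is justified by locality of \<open>dir_deriv\<close>.\<close>
  have comm2: "D X (D (lie_bracket A Y Z) f) p = D X (D Y (D Z f)) p - D X (D Z (D Y f)) p"
    if S: "smooth_vf A U X" "smooth_vf A U Y" "smooth_vf A U Z" for X Y Z
  proof -
    have "D X (D Y (D Z f)) p = dir_deriv A (\<lambda>q. D (lie_bracket A Y Z) f q + D Z (D Y f) q) p (X p)"
      unfolding D_def[of X] using V comm[OF S(2,3) f]
      by (intro dir_deriv_cong[OF V(1) sD[OF S(2) sD[OF S(3) f]]]) auto
    also have "\<dots> = D X (D (lie_bracket A Y Z) f) p + D X (D Z (D Y f)) p"
      unfolding D_def[of X]
      by (intro dir_deriv_add[OF sD[OF smooth_lie_bracket[OF S(2,3)] f] sD[OF S(3) sD[OF S(2) f]] V(2)])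
    finally show ?thesis by simp
  qed
  have J: "dir_deriv A f p (lie_bracket A X (lie_bracket A Y Z) p) =
      D X (D Y (D Z f)) p - D X (D Z (D Y f)) p - (D Y (D Z (D X f)) p - D Z (D Y (D X f)) p)"
    if S: "smooth_vf A U X" "smooth_vf A U Y" "smooth_vf A U Z" for X Y Z
    using comm[OF S(1) smooth_lie_bracket[OF S(2,3)] f V(2)] comm2[OF S] comm[OF S(2,3) sD[OF S(1) f] V(2)]
    unfolding D_def by simp
  have "linear (dir_deriv A f p)" using linear_dir_deriv[OF f V(2)] .
  then show "dir_deriv A f p (lie_bracket A X (lie_bracket A Y Z) p + lie_bracket A Y (lie_bracket A Z X) p
      + lie_bracket A Z (lie_bracket A X Y) p) = dir_deriv A f p 0"
    using J[OF X Y Z] J[OF Y Z X] J[OF Z X Y] by (simp add: linear_add linear_0)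
qed

text \<open>Regrouped by torsion-freeness, the cyclic sum of curvatures becomes the cyclic sum of
  nested brackets, which is the Jacobi identity.\<close>

lemma curvature_bianchi:
  assumes X: "smooth_vf A U X" and Y: "smooth_vf A U Y" and Z: "smooth_vf A U Z" and p: "p \<in> U"
  shows "curvature A nabla X Y Z p + curvature A nabla Y Z X p + curvature A nabla Z X Y p = 0"
proof -
  have bracket: "nabla p v (cov nabla X Y) - nabla p v (cov nabla Y X) = nabla p v (lie_bracket A X Y)"
    if S: "smooth_vf A U X" "smooth_vf A U Y" for X Y v
  proof -
    have "nabla p v (cov nabla X Y) = nabla p v (\<lambda>q. lie_bracket A X Y q + cov nabla Y X q)"
      using S p by (intro nabla_cong[symmetric] smooth_cov) (simp_all add: torsion_free cov_def)
    then show ?thesis using S p by (simp add: nabla_add smooth_cov smooth_lie_bracket)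
  qed
  have "curvature A nabla X Y Z p + curvature A nabla Y Z X p + curvature A nabla Z X Y p
    = (nabla p (X p) (lie_bracket A Y Z) - nabla p (lie_bracket A Y Z p) X)
    + (nabla p (Y p) (lie_bracket A Z X) - nabla p (lie_bracket A Z X p) Y)
    + (nabla p (Z p) (lie_bracket A X Y) - nabla p (lie_bracket A X Y p) Z)"
    unfolding bracket[OF X Y, symmetric] bracket[OF Y Z, symmetric] bracket[OF Z X, symmetric]
    by (simp add: curvature_def cov_def[of nabla _ _ p])
  also have "\<dots> = 0"
    using jacobi[OF X Y Z p] X Y Z p by (simp add: torsion_free smooth_lie_bracket)
  finally show ?thesis .
qed

end

section \<open>Nearly Kaehler manifolds\<close>

locale nearly_kaehler_region = levi_civita_region A g nabla U
  for A :: "('m::{t2_space,second_countable_topology}, 'e::euclidean_space) chart set" and g nabla U +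
  fixes J :: "'m \<Rightarrow> 'e \<Rightarrow> 'e"
  assumes nearly_kaehler: "nearly_kaehler A g J nabla"
begin

lemma J_smooth:
  assumes "smooth_vf A U X" shows "smooth_vf A U (\<lambda>q. J q (X q))"
  using nearly_kaehler open_U assms by (simp add: nearly_kaehler_def almost_hermitian_def)

lemma J_linear: "linear (J p)" and J_J [simp]: "J p (J p v) = - v" and g_J_J: "g p (J p u) (J p v) = g p u v"
  using nearly_kaehler by (simp_all add: nearly_kaehler_def almost_hermitian_def)

lemmas J_simps = linear_add[OF J_linear] linear_diff[OF J_linear] linear_neg[OF J_linear]

lemma g_J_left: "g p (J p u) v = - g p u (J p v)"
  using g_J_J[of p u "J p v"] by (simp add: g_linear)

lemma g_J_self: "g p u (J p u) = 0"
  using g_J_left[of p u u] g_sym[of p u "J p u"] by simp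

section \<open>The covariant derivative of \<open>J\<close> and Gray's identity\<close>

abbreviation P :: "('m \<Rightarrow> 'e) \<Rightarrow> ('m \<Rightarrow> 'e) \<Rightarrow> 'm \<Rightarrow> 'e" where "P \<equiv> cov_J nabla J"

lemma cov_J_eq: "cov nabla X (\<lambda>q. J q (Y q)) p = P X Y p + J p (cov nabla X Y p)"
  by (simp add: cov_J_def)

lemma P_skew:
  assumes "smooth_vf A U X" "smooth_vf A U Y" "p \<in> U" shows "P X Y p = - P Y X p"
proof -
  have "P X Y p + P Y X p = 0"
    using nearly_kaehler[unfolded nearly_kaehler_def, THEN conjunct2, THEN conjunct2, rule_format, of U X Y p]
      open_U assms by simp
  then show ?thesis by (simp add: eq_neg_iff_add_eq_0)
qed

lemma P_same: assumes "smooth_vf A U X" "p \<in> U" shows "P X X p = 0"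
proof -
  have "2 *\<^sub>R P X X p = 0" using P_skew[OF assms(1) assms] by (simp add: scaleR_2 eq_neg_iff_add_eq_0)
  then show ?thesis by simp
qed

lemma smooth_P:
  assumes "smooth_vf A U X" "smooth_vf A U Y" shows "smooth_vf A U (P X Y)"
  unfolding cov_J_def[abs_def] using assms by (intro smooth_vf_diff[OF open_U] J_smooth smooth_cov)

text \<open>Differentiates the relation \<open>g(JY,Z) + g(Y,JZ) = 0\<close>, the skewness of
  \<open>J\<close>.\<close>

lemma P_metric:
  assumes X: "smooth_vf A U X" and Y: "smooth_vf A U Y" and Z: "smooth_vf A U Z" and p: "p \<in> U"
  shows "g p (P X Y p) (Z p) = - g p (Y p) (P X Z p)"
proof -
  have "dir_deriv A (\<lambda>q. g q (J q (Y q)) (Z q) + g q (Y q) (J q (Z q))) p (X p) = 0"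
    by (simp add: g_J_left)
  then have "dir_deriv A (\<lambda>q. g q (J q (Y q)) (Z q)) p (X p) + dir_deriv A (\<lambda>q. g q (Y q) (J q (Z q))) p (X p) = 0"
    using dir_deriv_add[OF smooth_metric[OF J_smooth[OF Y] Z] smooth_metric[OF Y J_smooth[OF Z]] p, of "X p"] by simp
  then show ?thesis
    using metric_compatible[OF J_smooth[OF Y] Z p, of "X p"] metric_compatible[OF Y J_smooth[OF Z] p, of "X p"]
    by (simp add: cov_J_def cov_def g_linear g_J_left)
qed

text \<open>Differentiates \<open>J(JY) = -Y\<close>.\<close>

lemma P_J_right:
  assumes "smooth_vf A U Y" "p \<in> U" shows "P X (\<lambda>q. J q (Y q)) p = - J p (P X Y p)"
  using nabla_uminus[OF assms] by (simp add: cov_J_def cov_def J_simps)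

lemma P_J_same_orth:
  assumes X: "smooth_vf A U X" and Y: "smooth_vf A U Y" and p: "p \<in> U"
  shows "g p (P X Y p) (J p (X p)) = 0"
  using P_metric[OF X Y J_smooth[OF X] p] P_J_right[OF X p] P_same[OF X p]
  by (simp add: linear_0[OF J_linear] g_linear)

text \<open>Gray's identity, obtained by differentiating \<open>(\<nabla>\<^sub>X J) W \<bottom> J X\<close> along \<open>W\<close>.\<close>

lemma curvature_minus_curvature_J:
  assumes W: "smooth_vf A U W" and X: "smooth_vf A U X" and p: "p \<in> U"
  shows "g p (curvature A nabla W X (\<lambda>q. J q (W q)) p) (J p (X p)) - g p (curvature A nabla W X W p) (X p)
    = g p (P W X p) (P W X p)"
proof -
  let ?JW = "\<lambda>q. J q (W q)" and ?JX = "\<lambda>q. J q (X q)"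
  note cWX = smooth_cov[OF W X] and cXW = smooth_cov[OF X W] and cWW = smooth_cov[OF W W]
  have nJ: "nabla p (Y p) (\<lambda>q. J q (Z q)) = P Y Z p + J p (nabla p (Y p) Z)" for Y Z
    by (simp add: cov_J_def cov_def)
  have 1: "nabla p (W p) (cov nabla X ?JW) = nabla p (W p) (P X W) + (P W (cov nabla X W) p + J p (nabla p (W p) (cov nabla X W)))"
    unfolding nJ[symmetric] cov_J_eq[abs_def]
    by (rule nabla_add[OF smooth_P[OF X W] J_smooth[OF cXW] p])
  \<comment> \<open>\<open>P W W\<close> vanishes on all of \<open>U\<close>, so
    \<open>nabla_W (J W) = J (nabla_W W)\<close> there and may be differentiated along
    \<open>X\<close>.\<close>
  have "nabla p (X p) (cov nabla W ?JW) = nabla p (X p) (\<lambda>q. J q (cov nabla W W q))"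
    using p by (intro nabla_cong J_smooth cWW) (simp_all add: cov_J_eq P_same W)
  then have 2: "nabla p (X p) (cov nabla W ?JW) = P X (cov nabla W W) p + J p (nabla p (X p) (cov nabla W W))"
    using nJ by simp
  have 3: "nabla p (lie_bracket A W X p) ?JW = P (cov nabla W X) W p - P (cov nabla X W) W p
      + J p (nabla p (lie_bracket A W X p) W)"
    using nJ[of "cov nabla W X" W] nJ[of "cov nabla X W" W] J_smooth[OF W] W X p
    by (simp add: torsion_free nabla_diff_left cov_def J_simps)
  \<comment> \<open>The term \<open>P W (nabla_X W)\<close> from the second derivative cancels
    against \<open>P (nabla_X W) W\<close> from the bracket, by skewness of
    \<open>P\<close>.\<close>
  have E: "curvature A nabla W X ?JW p - J p (curvature A nabla W X W p)
      = nabla p (W p) (P X W) - P X (cov nabla W W) p - P (cov nabla W X) W p"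
    using P_skew[OF W cXW p]
    by (simp add: curvature_def cov_def[of nabla _ _ p] 1 2 3 J_simps)
  have "dir_deriv A (\<lambda>q. g q (P X W q) (J q (X q))) p (W p) = dir_deriv A (\<lambda>q. 0) p (W p)"
    using p W X by (intro dir_deriv_cong[OF open_U] smooth_metric smooth_P J_smooth) (simp_all add: P_J_same_orth)
  then have d: "g p (nabla p (W p) (P X W)) (J p (X p)) = - g p (P X W p) (P W X p + J p (cov nabla W X p))"
    using metric_compatible[OF smooth_P[OF X W] J_smooth[OF X] p, of "W p"] nJ[of W X]
    by (simp add: cov_def)
  \<comment> \<open>The two remaining terms with \<open>nabla_W X\<close>, one from \<open>E\<close>
    and one from differentiating \<open>J X\<close>, are reduced to a common expression and
    cancel.\<close>
  have "g p (P (cov nabla W X) W p) (J p (X p)) = - g p (W p) (J p (P X (cov nabla W X) p))"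
    using P_metric[OF cWX W J_smooth[OF X] p] P_J_right[OF X p, of "cov nabla W X"] P_skew[OF cWX X p]
    by (simp add: J_simps)
  moreover have "g p (P X W p) (J p (cov nabla W X p)) = g p (W p) (J p (P X (cov nabla W X) p))"
    using P_metric[OF X W J_smooth[OF cWX] p] P_J_right[OF cWX p, of X] by (simp add: g_linear)
  moreover have "g p (curvature A nabla W X W p) (X p) = g p (J p (curvature A nabla W X W p)) (J p (X p))"
    by (simp add: g_J_J)
  moreover have "g p (curvature A nabla W X ?JW p - J p (curvature A nabla W X W p)) (J p (X p))
      = g p (P W X p) (P W X p) + 0"
    unfolding E using d calculation(1,2) P_J_same_orth[OF X cWW p] P_skew[OF X W p] by (simp add: g_linear)
  ultimately show ?thesis by (simp add: g_linear)
qed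

lemma nearly_kaehler_curvature:
  assumes c: "constant_holomorphic_sectional_curvature A g J nabla c"
    and \<alpha>: "constant_type A g J nabla \<alpha>" and p: "p \<in> U"
  shows "nearly_kaehler_curvature {X. smooth_vf A U X}
    (\<lambda>X Y Z W. g p (curvature A nabla X Y Z p) (W p)) (\<lambda>X q. J q (X q)) (\<lambda>X Y. g p (X p) (Y p)) c \<alpha>"
proof
  fix x y assume S: "x \<in> {X. smooth_vf A U X}" "y \<in> {X. smooth_vf A U X}"
  show "x + y \<in> {X. smooth_vf A U X}" using smooth_vf_add[OF open_U, of x y] S by (simp add: plus_fun_def)
  show "g p (curvature A nabla x y (\<lambda>q. J q (x q)) p) (J p (y p)) - g p (curvature A nabla x y x p) (y p) =
      \<alpha> * (g p (x p) (x p) * g p (y p) (y p) - (g p (x p) (y p))\<^sup>2 - (g p (x p) (J p (y p)))\<^sup>2)"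
    using curvature_minus_curvature_J[of x y p] \<alpha>[unfolded constant_type_def, rule_format, of U x y p] S p open_U
    by simp
next
  fix x assume S: "x \<in> {X. smooth_vf A U X}"
  show "- x \<in> {X. smooth_vf A U X}" using smooth_vf_uminus[OF open_U, of x] S by (simp add: fun_Compl_def)
  show "(\<lambda>q. J q (J q (x q))) = - x" by (simp add: fun_Compl_def)
  show "g p (curvature A nabla x (\<lambda>q. J q (x q)) (\<lambda>q. J q (x q)) p) (x p) = c * (g p (x p) (x p))\<^sup>2"
  \<comment> \<open>At a zero of the field there is no plane and the curvature hypothesis is silent,
    but both sides of the polynomial form vanish.\<close>
  proof (cases "x p = 0")
    case True then show ?thesis by (simp add: g_linear)
  next
    case False
    then have "sectional_curvature A g nabla x (\<lambda>q. J q (x q)) p = c"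
      using c[unfolded constant_holomorphic_sectional_curvature_def, rule_format, of U x p] S p open_U by simp
    then show ?thesis using g_pos[OF False, of p]
      by (simp add: sectional_curvature_def g_J_J g_J_self power2_eq_square field_simps)
  qed
next
  fix x y z w assume S: "x \<in> {X. smooth_vf A U X}" "y \<in> {X. smooth_vf A U X}" "z \<in> {X. smooth_vf A U X}" "w \<in> {X. smooth_vf A U X}"
  show "g p (curvature A nabla y x z p) (w p) = - g p (curvature A nabla x y z p) (w p)"
    using curvature_skew12[of x y z p] S p by (simp add: g_linear)
  show "g p (curvature A nabla x y w p) (z p) = - g p (curvature A nabla x y z p) (w p)"
    using curvature_skew34[of x y z w p] S p by simp
  show "g p (curvature A nabla x y z p) (w p) + g p (curvature A nabla y z x p) (w p) + g p (curvature A nabla z x y p) (w p) = 0"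
    using curvature_bianchi[of x y z p] S p by (simp add: g_linear[symmetric]) (simp add: g_linear)
next
  fix x x' y z w assume S: "x \<in> {X. smooth_vf A U X}" "x' \<in> {X. smooth_vf A U X}" "y \<in> {X. smooth_vf A U X}"
    "z \<in> {X. smooth_vf A U X}" "w \<in> {X. smooth_vf A U X}"
  show "g p (curvature A nabla (x + x') y z p) (w p) = g p (curvature A nabla x y z p) (w p) + g p (curvature A nabla x' y z p) (w p)"
    using curvature_add1[of x x' y z p] S p by (simp add: g_linear)
qed (auto simp: J_smooth J_simps g_linear g_sym g_J_J plus_fun_def)

end

section \<open>Local sections of distributions\<close>

context smooth_manifold
begin

text \<open>Smooth elimination, one equation at a time: a solution of the first \<open>n\<close>
  equations is corrected by a multiple of another such solution on which \<open>L n\<close> does not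
  vanish. Independence is required in triangular form and at \<open>p\<close> only, since
  nonvanishing persists nearby.\<close>

lemma local_section:
  fixes L :: "nat \<Rightarrow> 'm \<Rightarrow> 'e \<Rightarrow> real"
  assumes U: "open U" "p \<in> U"
    and lin: "\<And>i q. i < n \<Longrightarrow> q \<in> U \<Longrightarrow> linear (L i q)"
    and smooth: "\<And>i V X. i < n \<Longrightarrow> open V \<Longrightarrow> V \<subseteq> U \<Longrightarrow> smooth_vf A V X \<Longrightarrow> smooth_fun A V (\<lambda>q. L i q (X q))"
    and indep: "\<And>i. i < n \<Longrightarrow> \<exists>w. (\<forall>j<i. L j p w = 0) \<and> L i p w \<noteq> 0"
    and z: "\<And>i. i < n \<Longrightarrow> L i p z = 0"
  shows "\<exists>V X. open V \<and> p \<in> V \<and> V \<subseteq> U \<and> smooth_vf A V X \<and> X p = z \<and> (\<forall>i<n. \<forall>q\<in>V. L i q (X q) = 0)"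
  using lin smooth indep z
proof (induction n arbitrary: z)
  case 0
  have "smooth_vf A (U \<inter> cdom (chart_at A p)) (const_vf p z)"
    by (rule smooth_vf_subset[OF smooth_const_vf]) blast
  then show ?case
    using U chart_at[of p] by (intro exI[of _ "U \<inter> cdom (chart_at A p)"] exI[of _ "const_vf p z"])
      (auto simp: open_cdom const_vf_self)
next
  case (Suc n)
  have IH: "\<exists>V X. open V \<and> p \<in> V \<and> V \<subseteq> U \<and> smooth_vf A V X \<and> X p = y \<and> (\<forall>i<n. \<forall>q\<in>V. L i q (X q) = 0)"
    if "\<And>i. i < n \<Longrightarrow> L i p y = 0" for y
    using that Suc.prems(1-3) by (intro Suc.IH) auto
  obtain w where w: "\<And>j. j < n \<Longrightarrow> L j p w = 0" "L n p w \<noteq> 0" using Suc.prems(3)[of n] by auto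
  obtain V0 Z where V0: "open V0" "p \<in> V0" "V0 \<subseteq> U" and Z: "smooth_vf A V0 Z" "Z p = z" "\<And>i q. i < n \<Longrightarrow> q \<in> V0 \<Longrightarrow> L i q (Z q) = 0"
    using IH[of z] Suc.prems(4) by auto
  obtain V1 W where V1: "open V1" "p \<in> V1" "V1 \<subseteq> U" and W: "smooth_vf A V1 W" "W p = w" "\<And>i q. i < n \<Longrightarrow> q \<in> V1 \<Longrightarrow> L i q (W q) = 0"
    using IH[of w] w(1) by auto
  obtain V where V: "open V" "p \<in> V" "V \<subseteq> V0 \<inter> V1" and nz: "\<And>q. q \<in> V \<Longrightarrow> L n q (W q) \<noteq> 0"
    using smooth_fun_nonzero_nbhd[of "V0 \<inter> V1" "\<lambda>q. L n q (W q)" p] V0 V1 w(2) W(2)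
      Suc.prems(2)[of n "V0 \<inter> V1" W] smooth_vf_subset[OF W(1), of "V0 \<inter> V1"] by auto
  have ZV: "smooth_vf A V Z" and WV: "smooth_vf A V W" using V smooth_vf_subset Z W by blast+
  \<comment> \<open>The coefficient that annihilates \<open>L n\<close>. It is 0 at \<open>p\<close>
    because \<open>z\<close> already solves the equation there, so the prescribed value
    survives.\<close>
  define f where "f q = - (L n q (Z q) * inverse (L n q (W q)))" for q
  have LV: "smooth_fun A V (\<lambda>q. L n q (Y q))" if "smooth_vf A V Y" for Y
    using Suc.prems(2)[of n V Y] V V0 that by auto
  have "smooth_fun A V (\<lambda>q. (-1) * (L n q (Z q) * inverse (L n q (W q))))"
    by (intro smooth_fun_mult smooth_fun_const smooth_fun_inverse V(1) LV ZV WV nz)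
  then have f: "smooth_fun A V f" by (simp add: f_def[abs_def])
  have "smooth_vf A V (\<lambda>q. Z q + f q *\<^sub>R W q)"
    by (intro smooth_vf_add smooth_vf_scaleR V(1) f ZV WV)
  moreover have "Z p + f p *\<^sub>R W p = z" using Suc.prems(4)[of n] Z(2) by (simp add: f_def)
  moreover have "L i q (Z q + f q *\<^sub>R W q) = 0" if "i < Suc n" "q \<in> V" for i q
  proof -
    have q: "q \<in> V0" "q \<in> V1" using that(2) V(3) by auto
    have "linear (L i q)" using Suc.prems(1)[OF that(1)] that(2) V V0 by auto
    then have "L i q (Z q + f q *\<^sub>R W q) = L i q (Z q) + f q * L i q (W q)"
      by (simp add: linear_add linear_scale)
    then show ?thesis
      using that(1) Z(3)[OF _ q(1), of i] W(3)[OF _ q(2), of i] nz[OF that(2)] by (cases "i = n") (auto simp: f_def)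
  qed
  ultimately show ?case using V V0 by (intro exI[of _ V] exI[of _ "\<lambda>q. Z q + f q *\<^sub>R W q"]) auto
qed

lemma tchart_eq_0_iff:
  assumes "c \<in> A" "q \<in> cdom c" shows "tchart A c q v = 0 \<longleftrightarrow> v = 0"
proof
  assume "tchart A c q v = 0"
  then have "tchart A (chart_at A q) q v = 0"
    unfolding tchart_change_chart[OF assms chart_at]
    using linear_0[OF linear_frechet_derivative[OF differentiable_transition[OF assms(1) chart_at(1) assms(2) chart_at(2)]]]
    by simp
  then show "v = 0" by simp
qed (simp add: linear_0[OF linear_tchart[OF assms]])

end

context levi_civita_region
begin

text \<open>Gram-Schmidt with respect to \<open>g p\<close>, to which the inner product of the model
  space is unrelated. \<open>a'\<close> is the part of the new vector orthogonal to
  \<open>span S\<close>.\<close>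

lemma orthogonal_projection_exists:
  assumes "finite S"
  shows "\<exists>u\<in>span S. \<forall>s\<in>span S. g p s (v - u) = 0"
  using assms
proof (induction S arbitrary: v)
  case empty
  then show ?case by (simp add: g_linear)
next
  case (insert a S)
  obtain b where b: "b \<in> span S" "\<forall>s\<in>span S. g p s (a - b) = 0" using insert.IH by blast
  obtain u where u: "u \<in> span S" "\<forall>s\<in>span S. g p s (v - u) = 0" using insert.IH by blast
  define a' where "a' = a - b"
  \<comment> \<open>If \<open>a\<close> already lies in the span, then \<open>a' = 0\<close> and the
    quotient is 0, which is the correct coefficient.\<close>
  define t where "t = g p a' v / g p a' a'"
  have sub: "span S \<subseteq> span (insert a S)" by (intro span_mono) blast
  have a': "a' \<in> span (insert a S)"
    unfolding a'_def using b(1) sub by (intro span_diff) (auto intro: span_base)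
  have "g p a' u = 0" using b(2) u(1) g_sym[of p a' u] by (simp add: a'_def)
  then have t: "g p a' (v - (u + t *\<^sub>R a')) = 0"
    using g_pos[of a' p] by (cases "a' = 0") (auto simp: g_linear t_def)
  have "g p s (v - (u + t *\<^sub>R a')) = 0" if s: "s \<in> span (insert a S)" for s
  proof -
    obtain k where k: "s - k *\<^sub>R a \<in> span S" using s by (auto simp: span_insert)
    define s' where "s' = s - k *\<^sub>R a + k *\<^sub>R b"
    have s': "s' \<in> span S" unfolding s'_def using k b(1) by (intro span_add span_scale)
    have "g p s' (v - (u + t *\<^sub>R a')) = 0"
      using b(2) u(2) s' by (simp add: g_linear a'_def)
    moreover have "s = s' + k *\<^sub>R a'" by (simp add: s'_def a'_def algebra_simps)
    then have "g p s (v - (u + t *\<^sub>R a')) = g p s' (v - (u + t *\<^sub>R a')) + k * g p a' (v - (u + t *\<^sub>R a'))"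
      by (simp only: bilinear_ladd[OF bilinear_g] bilinear_lmul[OF bilinear_g] real_scaleR_def)
    ultimately show ?thesis using t by simp
  qed
  moreover have "u + t *\<^sub>R a' \<in> span (insert a S)" using u(1) sub a' by (intro span_add span_scale) auto
  ultimately show ?case by blast
qed

lemma orthogonal_projection_subspace:
  assumes "subspace V"
  shows "\<exists>u\<in>V. \<forall>s\<in>V. g p s (v - u) = 0"
proof -
  obtain S where S: "S \<subseteq> V" "independent S" "V \<subseteq> span S" using basis_exists[of V] by metis
  have "span S = V" using span_minimal[OF S(1) assms] S(3) by (rule subset_antisym)
  then show ?thesis using orthogonal_projection_exists[OF independent_imp_finite[OF S(2)], of p v] by simp
qed

end

section \<open>Submersions with totally umbilical fibers\<close>

locale submersion_region = levi_civita_region A g nabla U + target: smooth_manifold B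
  for A :: "('m::{t2_space,second_countable_topology}, 'e::euclidean_space) chart set"
    and g nabla U and B :: "('b::{t2_space,second_countable_topology}, 'f::euclidean_space) chart set" +
  fixes F :: "'m \<Rightarrow> 'b"
  assumes smooth_F: "smooth_map A B F"
begin

abbreviation vert :: "'m \<Rightarrow> 'e set" where "vert \<equiv> vertical A B F"

lemma open_preimage: "d \<in> B \<Longrightarrow> open (F -` cdom d)"
  using smooth_F by (intro open_vimage target.open_cdom) (simp_all add: smooth_map_def)

lemma differentiable_F:
  assumes "d \<in> B" "F q \<in> cdom d"
  shows "(cmap d \<circ> F \<circ> cinv (chart_at A q)) differentiable (at (cmap (chart_at A q) q))"
proof -
  have "smooth_on (cmap (chart_at A q) ` (cdom (chart_at A q) \<inter> F -` cdom d)) (cmap d \<circ> F \<circ> cinv (chart_at A q))"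
    using smooth_F chart_at(1)[of q] assms(1) by (simp add: smooth_map_def)
  then show ?thesis using chart_at(2)[of q] assms(2) by (intro smooth_on_imp_differentiable) auto
qed

lemma linear_differential: "linear (differential A B F q)"
  unfolding differential_def by (intro linear_frechet_derivative differentiable_F target.chart_at)

lemma subspace_vert: "subspace (vert q)"
  using linear_differential[of q] unfolding vertical_def
  by (auto simp: subspace_def linear_0 linear_add linear_scale)

text \<open>Base coordinates pulled back by \<open>F\<close>, with the base chart held fixed while
  \<open>q\<close> moves. Their differentials are the smooth covectors that cut out the vertical
  spaces.\<close>

definition fiber_coord :: "('b, 'f) chart \<Rightarrow> 'f \<Rightarrow> 'm \<Rightarrow> real" where
  "fiber_coord d b q = cmap d (F q) \<bullet> b"

lemma smooth_fiber_coord: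
  assumes d: "d \<in> B" shows "smooth_fun A (F -` cdom d) (fiber_coord d b)"
  unfolding smooth_fun_def
proof
  fix c assume c: "c \<in> A"
  have "smooth_on (cmap c ` (cdom c \<inter> F -` cdom d)) (cmap d \<circ> F \<circ> cinv c)"
    using c d smooth_F by (simp add: smooth_map_def)
  from smooth_on_bounded_linear_comp[OF bounded_linear_inner_left _ this]
  have "smooth_on (cmap c ` (cdom c \<inter> F -` cdom d)) (\<lambda>x. (cmap d \<circ> F \<circ> cinv c) x \<bullet> b)"
    using open_image[OF c open_preimage[OF d]] by (simp add: Int_commute)
  then show "smooth_on (cmap c ` (F -` cdom d \<inter> cdom c)) (fiber_coord d b \<circ> cinv c)"
    by (simp add: fiber_coord_def[abs_def] comp_def Int_commute)
qed

lemma dir_deriv_fiber_coord: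
  assumes d: "d \<in> B" "F q \<in> cdom d"
  shows "dir_deriv A (fiber_coord d b) q v = tchart B d (F q) (differential A B F q v) \<bullet> b"
proof -
  let ?c = "chart_at A q" and ?d = "chart_at B (F q)"
  let ?x = "cmap ?c q"
  let ?F = "cmap ?d \<circ> F \<circ> cinv ?c"
  have Fx: "?F ?x = cmap ?d (F q)" by (simp add: cinv_cmap chart_at)
  have "(?F has_derivative differential A B F q) (at ?x)"
    unfolding differential_def using differentiable_F[OF target.chart_at] by (simp add: frechet_derivative_works)
  moreover have "(cmap d \<circ> cinv ?d has_derivative tchart B d (F q)) (at (?F ?x))"
    unfolding tchart_def Fx using target.differentiable_transition[OF target.chart_at(1) d(1) target.chart_at(2) d(2)]
    by (simp add: frechet_derivative_works)
  ultimately have "((cmap d \<circ> cinv ?d) \<circ> ?F has_derivative tchart B d (F q) \<circ> differential A B F q) (at ?x)"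
    by (rule diff_chain_at)
  then have h: "((\<lambda>x. ((cmap d \<circ> cinv ?d) \<circ> ?F) x \<bullet> b) has_derivative
      (\<lambda>v. (tchart B d (F q) \<circ> differential A B F q) v \<bullet> b)) (at ?x)"
    by (rule has_derivative_inner_left)
  have "(fiber_coord d b \<circ> cinv ?c has_derivative (\<lambda>v. (tchart B d (F q) \<circ> differential A B F q) v \<bullet> b)) (at ?x)"
  proof (rule has_derivative_transform_within_open[OF h])
    show "open (cmap ?c ` (F -` cdom ?d \<inter> cdom ?c))"
      by (intro open_image chart_at open_preimage target.chart_at)
    show "?x \<in> cmap ?c ` (F -` cdom ?d \<inter> cdom ?c)" using chart_at(2)[of q] target.chart_at(2)[of "F q"] by blast
    show "((cmap d \<circ> cinv ?d) \<circ> ?F) x \<bullet> b = (fiber_coord d b \<circ> cinv ?c) x"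
      if "x \<in> cmap ?c ` (F -` cdom ?d \<inter> cdom ?c)" for x
      using that by (auto simp: fiber_coord_def cinv_cmap chart_at target.cinv_cmap target.chart_at)
  qed
  from fun_cong[OF frechet_derivative_at[OF this], of v] show ?thesis by (simp add: dir_deriv_def)
qed

lemma vert_iff_dir_deriv:
  assumes d: "d \<in> B" "F q \<in> cdom d"
  shows "v \<in> vert q \<longleftrightarrow> (\<forall>b\<in>Basis. dir_deriv A (fiber_coord d b) q v = 0)"
  by (simp add: vertical_def dir_deriv_fiber_coord[OF d] euclidean_all_zero_iff target.tchart_eq_0_iff[OF d])

lemma vproj_unique:
  assumes "u \<in> vert p" "v - u \<in> orth g vert p" shows "vproj A g B F p v = u"
  unfolding vproj_def
proof (rule the_equality)
  show "u \<in> vert p \<and> v - u \<in> orth g vert p" using assms by simp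
  fix u' assume u': "u' \<in> vert p \<and> v - u' \<in> orth g vert p"
  have "u' - u \<in> vert p" using u' assms subspace_diff[OF subspace_vert] by blast
  then have "g p (u' - u) (v - u) = 0" "g p (u' - u) (v - u') = 0" using assms u' by (auto simp: orth_def)
  then have "g p (u' - u) (u' - u) = 0" by (simp add: g_linear)
  then show "u' = u" using g_pos[of "u' - u" p] by fastforce
qed

lemma vproj_vert: "v \<in> vert p \<Longrightarrow> vproj A g B F p v = v"
  by (rule vproj_unique) (auto simp: orth_def g_linear)

lemma vproj_in_vert: "vproj A g B F p v \<in> vert p"
proof -
  obtain u where "u \<in> vert p" "\<forall>s\<in>vert p. g p s (v - u) = 0"
    using orthogonal_projection_subspace[OF subspace_vert] by blast
  then show ?thesis using vproj_unique[of u p v] by (simp add: orth_def)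
qed

end

locale umbilical_region = submersion_region A g nabla U B F
  for A :: "('m::{t2_space,second_countable_topology}, 'e::euclidean_space) chart set"
    and g nabla U and B :: "('b::{t2_space,second_countable_topology}, 'f::euclidean_space) chart set" and F +
  fixes H :: "'m \<Rightarrow> 'e"
  assumes umbilical: "\<And>X Y p. vertical_vf A B F U X \<Longrightarrow> vertical_vf A B F U Y \<Longrightarrow> p \<in> U \<Longrightarrow>
    oneill_T A g nabla B F X Y p = g p (X p) (Y p) *\<^sub>R H p"
begin

text \<open>The working form of umbilicity. For vertical fields the second summand of O'Neill's
  tensor drops out, since \<open>hproj\<close> of \<open>Y\<close> is zero on \<open>U\<close>; the
  first is the horizontal part of \<open>nabla_X Y\<close>.\<close>

lemma nabla_vertical:
  assumes X: "vertical_vf A B F U X" and Y: "vertical_vf A B F U Y" and p: "p \<in> U"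
  shows "nabla p (X p) Y - g p (X p) (Y p) *\<^sub>R H p \<in> vert p"
proof -
  have Xp: "vproj A g B F p (X p) = X p" and Yv: "\<And>q. q \<in> U \<Longrightarrow> vproj A g B F q (Y q) = Y q"
    using X Y p by (auto simp: vertical_vf_def vproj_vert)
  have "nabla p (X p) (\<lambda>q. vproj A g B F q (Y q)) = nabla p (X p) Y"
    using Y p Yv by (intro nabla_cong) (auto simp: vertical_vf_def)
  moreover have "nabla p (X p) (\<lambda>q. hproj A g B F q (Y q)) = 0"
    using p Yv by (intro nabla_zero) (auto simp: hproj_def)
  moreover have "vproj A g B F p 0 = 0" using subspace_0[OF subspace_vert] by (rule vproj_vert)
  ultimately have "oneill_T A g nabla B F X Y p = hproj A g B F p (nabla p (X p) Y)"
    by (simp add: oneill_T_def Let_def cov_def Xp)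
  then have "nabla p (X p) Y - g p (X p) (Y p) *\<^sub>R H p = vproj A g B F p (nabla p (X p) Y)"
    using umbilical[OF X Y p] by (simp add: hproj_def algebra_simps)
  then show ?thesis by (simp add: vproj_in_vert)
qed

text \<open>The multiple of \<open>H\<close> in \<open>nabla_vertical\<close> is symmetric in the
  two fields and cancels in the bracket.\<close>

lemma vertical_lie_bracket:
  assumes X: "vertical_vf A B F U X" and Y: "vertical_vf A B F U Y"
  shows "vertical_vf A B F U (lie_bracket A X Y)"
proof -
  have s: "smooth_vf A U X" "smooth_vf A U Y" using X Y by (auto simp: vertical_vf_def)
  have "lie_bracket A X Y q \<in> vert q" if q: "q \<in> U" for q
    using subspace_diff[OF subspace_vert nabla_vertical[OF X Y q] nabla_vertical[OF Y X q]]
    by (simp add: torsion_free[OF s q] g_sym[of q "Y q" "X q"])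
  then show ?thesis using smooth_lie_bracket[OF s] by (simp add: vertical_vf_def)
qed

text \<open>Orthogonality makes \<open>nabla_X Z\<close> and \<open>nabla_Y Z\<close> vertical
  fields, so \<open>nabla_vertical\<close> applies to the second derivatives too. Up to a vertical
  vector the curvature is then a multiple of \<open>H\<close>, with coefficient
  \<open>g(X, nabla_Y Z) - g(Y, nabla_X Z) - g([X,Y], Z)\<close>; differentiating the two
  orthogonality relations shows that it is 0.\<close>

lemma curvature_vertical:
  assumes X: "vertical_vf A B F U X" and Y: "vertical_vf A B F U Y" and Z: "vertical_vf A B F U Z" and p: "p \<in> U"
    and XZ: "\<And>q. q \<in> U \<Longrightarrow> g q (X q) (Z q) = 0" and YZ: "\<And>q. q \<in> U \<Longrightarrow> g q (Y q) (Z q) = 0"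
  shows "curvature A nabla X Y Z p \<in> vert p"
proof -
  have s: "smooth_vf A U X" "smooth_vf A U Y" "smooth_vf A U Z" using X Y Z by (auto simp: vertical_vf_def)
  have cov_vert: "vertical_vf A B F U (cov nabla X Z)"
    if X: "vertical_vf A B F U X" and XZ: "\<And>q. q \<in> U \<Longrightarrow> g q (X q) (Z q) = 0" for X
    using nabla_vertical[OF X Z] XZ smooth_cov[of X Z] X s(3) by (auto simp: vertical_vf_def cov_def)
  have orth_deriv: "g p (nabla p v X) (Z p) + g p (X p) (nabla p v Z) = 0"
    if X: "smooth_vf A U X" and XZ: "\<And>q. q \<in> U \<Longrightarrow> g q (X q) (Z q) = 0" for X v
    using dir_deriv_cong[OF open_U smooth_metric[OF X s(3)] p XZ, of v] metric_compatible[OF X s(3) p, of v] by simp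
  have "nabla p (X p) (cov nabla Y Z) - g p (X p) (cov nabla Y Z p) *\<^sub>R H p \<in> vert p"
    "nabla p (Y p) (cov nabla X Z) - g p (Y p) (cov nabla X Z p) *\<^sub>R H p \<in> vert p"
    "nabla p (lie_bracket A X Y p) Z - g p (lie_bracket A X Y p) (Z p) *\<^sub>R H p \<in> vert p"
    by (intro nabla_vertical cov_vert vertical_lie_bracket X Y Z XZ YZ p; assumption)+
  from subspace_diff[OF subspace_vert subspace_diff[OF subspace_vert this(1,2)] this(3)]
  have "curvature A nabla X Y Z p - (g p (X p) (cov nabla Y Z p) - g p (Y p) (cov nabla X Z p)
      - g p (lie_bracket A X Y p) (Z p)) *\<^sub>R H p \<in> vert p"
    by (simp add: curvature_def cov_def[of nabla _ _ p] algebra_simps)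
  moreover have "g p (X p) (cov nabla Y Z p) - g p (Y p) (cov nabla X Z p) - g p (lie_bracket A X Y p) (Z p) = 0"
    using orth_deriv[OF s(1) XZ, of "Y p"] orth_deriv[OF s(2) YZ, of "X p"]
    by (simp add: torsion_free[OF s(1,2) p] g_linear cov_def)
  ultimately show ?thesis by simp
qed

end

lemma (in submersion_region) vertical_orthogonal_section:
  fixes X :: "nat \<Rightarrow> 'm \<Rightarrow> 'e"
  assumes surj: "surj (differential A B F p)" and p: "p \<in> U"
    and X: "\<And>i. i < k \<Longrightarrow> vertical_vf A B F U (X i)"
    and inj: "inj_on (\<lambda>i. X i p) {..<k}" and ind: "independent ((\<lambda>i. X i p) ` {..<k})"
    and z: "z \<in> vert p" "\<And>i. i < k \<Longrightarrow> g p (X i p) z = 0"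
  shows "\<exists>V Z. open V \<and> p \<in> V \<and> V \<subseteq> U \<and> vertical_vf A B F V Z \<and> Z p = z \<and> (\<forall>i<k. \<forall>q\<in>V. g q (X i q) (Z q) = 0)"
proof -
  define d where "d = chart_at B (F p)"
  have d: "d \<in> B" "F p \<in> cdom d" using target.chart_at by (auto simp: d_def)
  define W where "W = U \<inter> F -` cdom d"
  have W: "open W" "p \<in> W" using open_U open_preimage[OF d(1)] p d by (auto simp: W_def)
  define m where "m = DIM('f)"
  obtain b :: "nat \<Rightarrow> 'f" where b: "bij_betw b {0..<m} Basis"
    using ex_bij_betw_nat_finite[OF finite_Basis] by (auto simp: m_def)
  have b_Basis: "b i \<in> Basis" if "i < m" for i using b that by (auto simp: bij_betw_def)
  have b_all: "\<exists>i<m. b i = c" if "c \<in> Basis" for c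
    using b that by (metis atLeastLessThan_iff bij_betw_imp_surj_on imageE)
  have b_neq: "b i \<noteq> b j" if "i < m" "j < m" "i \<noteq> j" for i j
    using b that by (auto simp: bij_betw_def inj_on_def)
  \<comment> \<open>The first \<open>m\<close> equations say that a vector is vertical, the next
    \<open>k\<close> that it is orthogonal to the frame.\<close>
  define L where "L i q = (if i < m then dir_deriv A (fiber_coord d (b i)) q else g q (X (i - m) q))" for i q
  have X_sm: "smooth_vf A U (X i)" and X_vert: "\<And>q. q \<in> U \<Longrightarrow> X i q \<in> vert q" if "i < k" for i
    using X[OF that] by (auto simp: vertical_vf_def)
  have "\<exists>V Z. open V \<and> p \<in> V \<and> V \<subseteq> W \<and> smooth_vf A V Z \<and> Z p = z \<and> (\<forall>i<m + k. \<forall>q\<in>V. L i q (Z q) = 0)"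
  proof (rule local_section[OF W])
    fix i q assume "i < m + k" "q \<in> W"
    then show "linear (L i q)"
      using linear_dir_deriv[OF smooth_fiber_coord[OF d(1)], of q] bilinear_g[of q]
      by (auto simp: L_def W_def bilinear_def)
  next
    fix i V Y assume i: "i < m + k" and V: "open V" "V \<subseteq> W" and Y: "smooth_vf A V Y"
    show "smooth_fun A V (\<lambda>q. L i q (Y q))"
    proof (cases "i < m")
      case True
      have "V \<subseteq> F -` cdom d" using V by (auto simp: W_def)
      from smooth_fun_dir_deriv[OF V(1) smooth_fun_subset[OF smooth_fiber_coord[OF d(1)] this] Y]
      show ?thesis using True by (simp add: L_def)
    next
      case False
      have "smooth_vf A V (X (i - m))" using smooth_vf_subset[OF X_sm] V i False by (auto simp: W_def)
      then show ?thesis using False metric[unfolded riemannian_metric_def, THEN conjunct2, rule_format, of V "X (i - m)" Y] V Y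
        by (simp add: L_def)
    qed
  next
    fix i assume i: "i < m + k"
    show "\<exists>w. (\<forall>j<i. L j p w = 0) \<and> L i p w \<noteq> 0"
    proof (cases "i < m")
      case True
      \<comment> \<open>As \<open>d\<close> is the chart chosen at \<open>F p\<close>, lifting the
        basis vector \<open>b i\<close> gives a vector dual to the first \<open>m\<close>
        covectors.\<close>
      obtain w where "differential A B F p w = b i" using surj by (metis surjD)
      then have "L j p w = b i \<bullet> b j" if "j < m" for j
        using that dir_deriv_fiber_coord[OF d, of "b j" w] by (simp add: L_def d_def)
      then show ?thesis
        using True b_Basis[of i] inner_not_same_Basis[OF b_Basis b_Basis] b_neq[of i]
        by (intro exI[of _ w]) (auto simp: inner_same_Basis)
    next
      case False
      define l where "l = i - m"
      have l: "l < k" "i = m + l" using i False by (auto simp: l_def)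
      \<comment> \<open>The witness for the orthogonality equation of \<open>X l\<close> is the
        component \<open>w\<close> of \<open>X l\<close> orthogonal to the earlier frame vectors: it
        is vertical, nonzero by independence, and pairs with \<open>X l\<close> to
        \<open>g p w w\<close>.\<close>
      define S where "S = (\<lambda>i. X i p) ` {..<l}"
      obtain u where u: "u \<in> span S" "\<forall>s\<in>span S. g p s (X l p - u) = 0"
        using orthogonal_projection_exists[of S p "X l p"] by (auto simp: S_def)
      define w where "w = X l p - u"
      have "S \<subseteq> (\<lambda>i. X i p) ` {..<k} - {X l p}"
        using inj l by (auto simp: S_def inj_on_def)
      then have "X l p \<notin> span S" using ind l(1) span_mono unfolding dependent_def by blast
      then have w0: "w \<noteq> 0" using u(1) by (auto simp: w_def)
      have "span S \<subseteq> vert p" using X_vert p l by (intro span_minimal subspace_vert) (auto simp: S_def)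
      then have "w \<in> vert p" unfolding w_def using u(1) X_vert[OF l(1) p] by (intro subspace_diff[OF subspace_vert]) auto
      then have "L j p w = 0" if "j < m" for j using vert_iff_dir_deriv[OF d, of w] b_Basis that by (simp add: L_def)
      moreover have "L j p w = 0" if "\<not> j < m" "j < i" for j
      proof -
        have "X (j - m) p \<in> span S" using that l by (intro span_base) (auto simp: S_def)
        then show ?thesis using u(2) that by (simp add: L_def w_def)
      qed
      moreover have "g p (X l p) w = g p w w + g p u w" by (simp add: w_def g_linear)
      then have "L i p w \<noteq> 0" using g_pos[OF w0, of p] u l by (simp add: L_def w_def)
      ultimately show ?thesis by blast
    qed
  next
    fix i assume "i < m + k"
    then show "L i p z = 0" using z(1,2) vert_iff_dir_deriv[OF d, of z] b_Basis by (auto simp: L_def)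
  qed
  then obtain V Z where V: "open V" "p \<in> V" "V \<subseteq> W" and Z: "smooth_vf A V Z" "Z p = z"
    and L0: "\<And>i q. i < m + k \<Longrightarrow> q \<in> V \<Longrightarrow> L i q (Z q) = 0" by blast
  have "Z q \<in> vert q" if q: "q \<in> V" for q
  proof -
    have "dir_deriv A (fiber_coord d c) q (Z q) = 0" if c: "c \<in> Basis" for c
    proof -
      obtain i where "i < m" "b i = c" using b_all[OF c] by blast
      then show ?thesis using L0[OF _ q, of i] by (simp add: L_def)
    qed
    then show ?thesis using vert_iff_dir_deriv[OF d(1), of q "Z q"] q V(3) by (auto simp: W_def)
  qed
  moreover have "g q (X i q) (Z q) = 0" if "i < k" "q \<in> V" for i q
    using L0[OF _ that(2), of "m + i"] that(1) by (simp add: L_def)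
  ultimately show ?thesis using V Z by (intro exI[of _ V] exI[of _ Z]) (auto simp: vertical_vf_def W_def)
qed

theorem theorem3p28:
  fixes A :: "('m::{t2_space,second_countable_topology}, 'e::euclidean_space) chart set"
    and g :: "'m \<Rightarrow> 'e \<Rightarrow> 'e \<Rightarrow> real"
    and J :: "'m \<Rightarrow> 'e \<Rightarrow> 'e"
    and nabla :: "('m, 'e) conn"
    and B :: "('b::{t2_space,second_countable_topology}, 'f::euclidean_space) chart set"
    and h :: "'b \<Rightarrow> 'f \<Rightarrow> 'f \<Rightarrow> real"
    and F :: "'m \<Rightarrow> 'b"
    and D :: "'m \<Rightarrow> 'e set"
    and c \<alpha> :: real
  assumes "nearly_kaehler A g J nabla"
    and "riemannian_manifold B h"
    and "generic_riemannian_submersion A g J B h F D"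
    and "surj F"
    and "constant_holomorphic_sectional_curvature A g J nabla c"
    and "constant_type A g J nabla \<alpha>"
    and "\<forall>p. D p \<noteq> {0}"
    and "\<forall>p. orth_in_vertical A g B F D p \<noteq> {0}"
    and "integrable_distribution A D"
    and "totally_umbilical_fibers A g nabla B F"
  shows "c = \<alpha>"
proof -
  note nk = assms(1) and gen = assms(3)
  have rs: "riemannian_submersion A g B h F" and dist: "distribution A D"
    using gen by (auto simp: generic_riemannian_submersion_def)
  note generic = gen[unfolded generic_riemannian_submersion_def, THEN conjunct2, THEN conjunct2, rule_format]
  have D_vert: "D q \<subseteq> vertical A B F q" for q using generic[of q] by (elim conjE)
  have J_D: "J q ` D q = D q" for q using generic[of q] by (elim conjE)
  have real: "orth_in_vertical A g B F D q \<inter> J q ` orth_in_vertical A g B F D q = {0}" for q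
    using generic[of q] by (elim conjE)
  obtain H where H: "\<And>W U V p. open W \<Longrightarrow> vertical_vf A B F W U \<Longrightarrow> vertical_vf A B F W V \<Longrightarrow> p \<in> W \<Longrightarrow>
      oneill_T A g nabla B F U V p = g p (U p) (V p) *\<^sub>R H p"
    using assms(10) unfolding totally_umbilical_fibers_def by metis
  have atlas: "smooth_atlas A" and metric: "riemannian_metric A g" and lc: "levi_civita A g nabla"
    and atlasB: "smooth_atlas B" and F: "smooth_map A B F" and surj: "\<And>p. surj (differential A B F p)"
    using nk rs by (auto simp: nearly_kaehler_def almost_hermitian_def riemannian_manifold_def riemannian_submersion_def)
  \<comment> \<open>The claim concerns two numbers, so one point suffices.\<close>
  fix p :: 'm
  obtain k U and X :: "nat \<Rightarrow> 'm \<Rightarrow> 'e" where U0: "open U" "p \<in> U" and X0: "\<And>i. i < k \<Longrightarrow> smooth_vf A U (X i)"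
    and frame: "\<And>q. q \<in> U \<Longrightarrow> inj_on (\<lambda>i. X i q) {..<k} \<and> independent ((\<lambda>i. X i q) ` {..<k}) \<and>
      D q = span ((\<lambda>i. X i q) ` {..<k})"
    using dist unfolding distribution_def by metis
  \<comment> \<open>Restricting to the chart domain keeps constant-component fields smooth, as
    needed for \<open>N\<close>.\<close>
  define U1 where "U1 = U \<inter> cdom (chart_at A p)"
  interpret M: smooth_manifold A by (unfold_locales) (rule atlas)
  have U1: "open U1" "p \<in> U1" "U1 \<subseteq> U" "U1 \<subseteq> cdom (chart_at A p)"
    using U0 M.chart_at(2)[of p] M.open_cdom[OF M.chart_at(1), of p] by (auto simp: U1_def)
  interpret R1: submersion_region A g nabla U1 B F
    by unfold_locales (fact metric lc U1 atlasB F)+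
  have D_span: "D q = span ((\<lambda>i. X i q) ` {..<k})" if "q \<in> U1" for q using frame U1 that by auto
  have X_D: "X i q \<in> D q" if "i < k" "q \<in> U1" for i q
    unfolding D_span[OF that(2)] using that by (intro span_base) auto
  have X1: "vertical_vf A B F U1 (X i)" if "i < k" for i
    using M.smooth_vf_subset[OF X0[OF that] U1(3)] X_D[OF that] D_vert by (auto simp: vertical_vf_def)
  \<comment> \<open>Nontriviality of \<open>D\<close> provides the frame field \<open>X 0\<close>,
    which plays the role of \<open>X\<close> in the curvature identity.\<close>
  have k: "0 < k" using assms(7) D_span[OF U1(2)] by (metis gr0I image_empty lessThan_0 span_empty)
  have orth_iff: "v \<in> orth_in_vertical A g B F D q \<longleftrightarrow> v \<in> R1.vert q \<and> (\<forall>u\<in>D q. g q u v = 0)" for q v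
    by (auto simp: orth_in_vertical_def orth_def)
  have "0 \<in> orth_in_vertical A g B F D p"
    using subspace_0[OF R1.subspace_vert] by (simp add: orth_iff R1.g_linear)
  then obtain z where z: "z \<in> orth_in_vertical A g B F D p" "z \<noteq> 0" using assms(8) by blast
  have fr: "inj_on (\<lambda>i. X i p) {..<k}" "independent ((\<lambda>i. X i p) ` {..<k})" using frame[OF U0(2)] by auto
  have "\<exists>V Z. open V \<and> p \<in> V \<and> V \<subseteq> U1 \<and> vertical_vf A B F V Z \<and> Z p = z \<and> (\<forall>i<k. \<forall>q\<in>V. g q (X i q) (Z q) = 0)"
    by (rule R1.vertical_orthogonal_section[OF surj U1(2) X1 fr])
      (use z(1) X_D[OF _ U1(2)] in \<open>auto simp: orth_iff\<close>)
  then obtain V Z where V: "open V" "p \<in> V" "V \<subseteq> U1" and Z: "vertical_vf A B F V Z" "Z p = z"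
    and XZ: "\<And>i q. i < k \<Longrightarrow> q \<in> V \<Longrightarrow> g q (X i q) (Z q) = 0" by blast
  interpret V: nearly_kaehler_region A g nabla V J
    by unfold_locales (fact metric lc V nk)+
  interpret V: umbilical_region A g nabla V B F H
    by unfold_locales (fact atlasB F | rule H[OF V(1)]; assumption)+
  interpret C: nearly_kaehler_curvature "{X. smooth_vf A V X}"
    "\<lambda>X Y Z W. g p (curvature A nabla X Y Z p) (W p)" "\<lambda>X q. J q (X q)" "\<lambda>X Y. g p (X p) (Y p)" c \<alpha>
    by (rule V.nearly_kaehler_curvature[OF assms(5,6) V(2)])
  \<comment> \<open>Orthogonality to the frame is extended to its span because \<open>J Y\<close>
    lies in \<open>D\<close> without being a frame field.\<close>
  have D_Z: "g q u (Z q) = 0" if q: "q \<in> V" and u: "u \<in> D q" for q u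
  proof -
    have "subspace {u. g q u (Z q) = 0}" by (auto simp: subspace_def V.g_linear)
    then have "span ((\<lambda>i. X i q) ` {..<k}) \<subseteq> {u. g q u (Z q) = 0}"
      using XZ q by (intro span_minimal) auto
    then show ?thesis using u D_span q V(3) by auto
  qed
  define Y where "Y = X 0"
  have Y_D: "Y q \<in> D q" and JY_D: "J q (Y q) \<in> D q" if "q \<in> V" for q
    using X_D[OF k, of q] V(3) that J_D[of q] by (auto simp: Y_def)
  have sY: "smooth_vf A V Y" using M.smooth_vf_subset[of U1 Y V] X1[OF k] V(3) by (simp add: vertical_vf_def Y_def)
  have Y: "vertical_vf A B F V Y" and JY: "vertical_vf A B F V (\<lambda>q. J q (Y q))"
    using sY V.J_smooth[OF sY] Y_D JY_D D_vert by (auto simp: vertical_vf_def)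
  have sZ: "smooth_vf A V Z" using Z by (simp add: vertical_vf_def)
  have R_vert: "curvature A nabla Y (\<lambda>q. J q (Y q)) Z p \<in> V.vert p"
    using D_Z Y_D JY_D by (intro V.curvature_vertical[OF Y JY Z(1) V(2)]) auto
  obtain u where u: "u \<in> V.vert p" "\<And>s. s \<in> V.vert p \<Longrightarrow> g p s (J p z - u) = 0"
    using V.orthogonal_projection_subspace[OF V.subspace_vert, of p p "J p z"] by blast
  define n where "n = J p z - u"
  \<comment> \<open>If \<open>J z\<close> were vertical, then, being orthogonal to the
    \<open>J\<close>-invariant \<open>D\<close>, it would lie in the complement as well as in its
    image under \<open>J\<close>, and so vanish.\<close>
  have "n \<noteq> 0"
  proof
    assume "n = 0"
    then have "J p z \<in> V.vert p" using u(1) by (simp add: n_def)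
    moreover have "g p s (J p z) = 0" if "s \<in> D p" for s
    proof -
      have "J p s \<in> D p" using J_D[of p] that by blast
      then show ?thesis using z(1) V.g_J_left[of p s z] by (simp add: orth_iff)
    qed
    ultimately have "J p z \<in> {0}" using real[of p] z(1) by (auto simp: orth_iff)
    then have "J p (J p z) = 0" by (simp add: linear_0[OF V.J_linear])
    then show False using z(2) by simp
  qed
  define N where "N = M.const_vf p n"
  have sN: "smooth_vf A V N" unfolding N_def
    using V(3) U1(4) by (intro M.smooth_vf_subset[OF M.smooth_const_vf]) auto
  have Np: "N p = n" by (simp add: N_def M.const_vf_self)
  have n_orth: "g p s n = 0" if "s \<in> V.vert p" for s using u(2)[OF that] by (simp add: n_def)
  have YJY: "Y p \<in> V.vert p" "J p (Y p) \<in> V.vert p" using Y_D JY_D D_vert V(2) by blast+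
  \<comment> \<open>The sign is chosen so that \<open>J T\<close> is \<open>Z\<close> as a function,
    which lets the curvature identity meet \<open>R_vert\<close> directly.\<close>
  define T where "T = (\<lambda>q. - J q (Z q))"
  have sT: "smooth_vf A V T" unfolding T_def by (intro M.smooth_vf_uminus V(1) V.J_smooth sZ)
  have JT: "(\<lambda>q. J q (T q)) = Z" by (simp add: T_def V.J_simps)
  have YZ: "g p (Y p) (Z p) = 0" "g p (J p (Y p)) (Z p) = 0" using D_Z Y_D JY_D V(2) by auto
  have "2 * g p (curvature A nabla Y (\<lambda>q. J q (Y q)) (\<lambda>q. J q (T q)) p) (N p) = (c - \<alpha>) * g p (Y p) (Y p) * g p (T p) (N p)"
  proof (rule C.curvature_J_plane)
    show "Y \<in> {X. smooth_vf A V X}" "T \<in> {X. smooth_vf A V X}" "N \<in> {X. smooth_vf A V X}"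
      using sY sT sN by auto
    show "g p (Y p) (T p) = 0" using YZ(2) by (simp add: T_def V.g_linear V.g_J_left)
    show "g p (Y p) (J p (T p)) = 0" using YZ(1) by (simp add: T_def V.J_simps)
    show "g p (Y p) (N p) = 0" using n_orth[OF YJY(1)] by (simp add: Np)
    show "g p (Y p) (J p (N p)) = 0" using n_orth[OF YJY(2)] by (simp add: Np V.g_J_left)
  qed
  moreover have "g p (curvature A nabla Y (\<lambda>q. J q (Y q)) Z p) (N p) = 0"
    using n_orth[OF R_vert] by (simp add: Np)
  moreover have "g p (T p) (N p) = - g p n n"
  proof -
    have "T p = - (n + u)" by (simp add: T_def Z(2) n_def)
    then show ?thesis using n_orth[OF u(1)] by (simp add: V.g_linear Np)
  qed
  moreover have "Y p \<noteq> 0"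
  proof
    assume "Y p = 0"
    then have "X 0 p = 0" unfolding Y_def .
    moreover have "X 0 p \<in> (\<lambda>i. X i p) ` {..<k}" by (rule imageI) (simp add: k)
    ultimately have "dependent ((\<lambda>i. X i p) ` {..<k})" by (intro dependent_zero) (simp only:)
    with fr(2) show False by (rule notE)
  qed
  ultimately have "(c - \<alpha>) * g p (Y p) (Y p) * g p n n = 0" and "g p (Y p) (Y p) \<noteq> 0"
    unfolding JT using V.g_pos[of "Y p" p] by simp_all
  then show "c = \<alpha>" using V.g_pos[OF \<open>n \<noteq> 0\<close>, of p] by simp
qed

end
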